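(* Let $n\ge1$ and let $\lambda,\mu\vdash n$. Then $$\Big\langle s_n,\ [\mathbf{y}_\lambda\mathbf{z}_\mu]\prod_{\text{Lyndon words }w}\ \sum_{\text{partitions }\rho}\mathbf{y}_{\rho\cdot|w|}\,\mathbf{z}_{w^{|\rho|}}\,L_\rho[h_w]\Big\rangle=\#\{\alpha\sim\mu:\mathrm{type}(\alpha)=\lambda\},$$ where $[\mathbf{y}_\lambda\mathbf{z}_\mu]$ denotes extraction of the coefficient of $\mathbf{y}_\lambda\mathbf{z}_\mu$. (By Garsia and Reutenauer, the right-hand side is the Cartan invariant $[P_\mu:M_\lambda]$ of Solomon's descent algebra $\Sigma_n$.)
   Context: **Words.** A Lyndon word is a finite nonempty word on $\{1,2,\dots\}$ that is strictly lexicographically smaller than all its nontrivial cyclic rotations. Every word on $\{1,2,\dots\}$ factors uniquely as a concatenation $w_1w_2\cdots w_k$ of lexicographically weakly decreasing Lyndon words. For an integer composition $\alpha$ of $n$, $\mathrm{type}(\alpha)$ is the partition of $n$ obtained by sorting $|w_1|,\dots,|w_k|$, where $w_1\cdots w_k$ is the Lyndon factorization of $\alpha$ viewed as a word and $|w|$ denotes the sum of the letters of $w$. $\alpha\sim\mu$ means that the composition $\alpha$ rearranges to the partition $\mu$. For a composition, partition or word $\alpha=(\alpha_1,\dots,\alpha_k)$: $\mathbf{y}_\alpha=y_{\alpha_1}\cdots y_{\alpha_k}$, $\mathbf{z}_\alpha=z_{\alpha_1}\cdots z_{\alpha_k}$ (commuting variables), $|\alpha|=\alpha_1+\dots+\alpha_k$,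 $\alpha\cdot m=(\alpha_1m,\dots,\alpha_km)$, and $\alpha^m$ is the $m$-fold concatenation of $\alpha$. The sum over partitions $\rho$ includes the empty partition. **Symmetric functions.** $\mathrm{ch}$ is the Frobenius characteristic, $s_n=h_n$ is the Schur function of the one-row partition, $h_\alpha=h_{\alpha_1}h_{\alpha_2}\cdots$, $\langle\cdot,\cdot\rangle$ is the Hall inner product, $f[g]$ is plethysm. $L_m=\mathrm{ch}(\tilde H_{m-3}(\Pi_m)\otimes\mathrm{sgn}_{S_m})$ where $\tilde H_{m-3}(\Pi_m)$ is the top reduced homology (over $\mathbb{C}$) of the order complex of the proper part of the lattice $\Pi_m$ of set partitions of $\{1,\dots,m\}$, with the convention that it is the trivial one-dimensional representation for $m=1$ (degree $-2$) and $m=2$ (degree $-1$). For a partition $\rho=1^{m_1}2^{m_2}\cdots$, $L_\rho=\prod_i h_{m_i}[L_i]$ (so $L_\emptyset=1$). *)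

theory Defs
  imports
    Complex_Main
    "HOL-Library.Multiset"
    "HOL-Library.Disjoint_Sets"
    "HOL-Combinatorics.Permutations"
    "HOL-Combinatorics.Orbits"
begin

section \<open>Formal power series in arbitrarily many commuting variables\<close>

text \<open>
  A monomial is the finite multiset of the variables occurring in it, so that multiplication
  of monomials is multiset sum. A series is an arbitrary family of coefficients.
\<close>

typedef ('v, 'a) mfps = "UNIV :: ('v multiset \<Rightarrow> 'a) set"
  morphisms mcoeff Abs_mfps by simp

setup_lifting type_definition_mfps

lemma mfps_eqI: "(\<And>M. mcoeff f M = mcoeff g M) \<Longrightarrow> f = g"
  by (simp add: mcoeff_inject[symmetric] fun_eq_iff)

lemma mcoeff_Abs_mfps [simp]: "mcoeff (Abs_mfps f) = f"
  by (simp add: Abs_mfps_inverse)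

lemma finite_mset_splits: "finite {(A, B). A + B = (M :: 'v multiset)}"
proof (induction M)
  case empty
  have "{(A, B). A + B = ({#} :: 'v multiset)} = {({#}, {#})}" by auto
  then show ?case by simp
next
  case (add x M)
  let ?S = "{(A, B). A + B = M}"
  have "{(A, B). A + B = add_mset x M} \<subseteq>
      (\<lambda>(A, B). (add_mset x A, B)) ` ?S \<union> (\<lambda>(A, B). (A, add_mset x B)) ` ?S"
  proof (clarify)
    fix A B assume AB: "A + B = add_mset x M"
      and n: "(A, B) \<notin> (\<lambda>(A, B). (A, add_mset x B)) ` ?S"
    have "x \<in># A + B" using AB by simp
    then consider "x \<in># A" | "x \<in># B" by auto
    then show "(A, B) \<in> (\<lambda>(A, B). (add_mset x A, B)) ` ?S"
    proof cases
      case 1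
      then obtain A' where "A = add_mset x A'" by (blast dest: multi_member_split)
      then show ?thesis using AB by (force simp: image_iff)
    next
      case 2
      then obtain B' where "B = add_mset x B'" by (blast dest: multi_member_split)
      then show ?thesis using AB n by (force simp: image_iff)
    qed
  qed
  then show ?case using add by (meson finite_UnI finite_imageI finite_subset)
qed

instantiation mfps :: (type, comm_ring_1) comm_ring_1
begin

lift_definition zero_mfps :: "('a, 'b) mfps" is "\<lambda>_. 0" .
lift_definition one_mfps :: "('a, 'b) mfps" is "\<lambda>M. if M = {#} then 1 else 0" .
lift_definition plus_mfps :: "('a, 'b) mfps \<Rightarrow> ('a, 'b) mfps \<Rightarrow> ('a, 'b) mfps"
  is "\<lambda>f g M. f M + g M" .
lift_definition minus_mfps :: "('a, 'b) mfps \<Rightarrow> ('a, 'b) mfps \<Rightarrow> ('a, 'b) mfps"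
  is "\<lambda>f g M. f M - g M" .
lift_definition uminus_mfps :: "('a, 'b) mfps \<Rightarrow> ('a, 'b) mfps"
  is "\<lambda>f M. - f M" .
lift_definition times_mfps :: "('a, 'b) mfps \<Rightarrow> ('a, 'b) mfps \<Rightarrow> ('a, 'b) mfps"
  is "\<lambda>f g M. \<Sum>(A, B)\<in>{(A, B). A + B = M}. f A * g B" .

instance
proof
  fix a b c :: "('a, 'b) mfps"
  show "a + b + c = a + (b + c)" by transfer (simp add: add.assoc)
  show "a + b = b + a" by transfer (simp add: add.commute)
  show "0 + a = a" by transfer simp
  show "- a + a = 0" by transfer simp
  show "a - b = a + - b" by transfer simp
  show "(0 :: ('a, 'b) mfps) \<noteq> 1" by transfer (auto simp: fun_eq_iff)
  show "a * b = b * a"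
  proof (transfer, rule ext)
    fix f g :: "'a multiset \<Rightarrow> 'b" and M
    show "(\<Sum>(A, B)\<in>{(A, B). A + B = M}. f A * g B) =
          (\<Sum>(A, B)\<in>{(A, B). A + B = M}. g A * f B)"
      by (rule sum.reindex_bij_witness[where i = prod.swap and j = prod.swap])
        (auto simp: ac_simps)
  qed
  show "1 * a = a"
  proof (transfer, rule ext)
    fix f :: "'a multiset \<Rightarrow> 'b" and M
    have "(\<Sum>(A, B)\<in>{(A, B). A + B = M}. (if A = {#} then 1 else 0) * f B) =
          (\<Sum>(A, B)\<in>{({#} :: 'a multiset, M)}. (if A = {#} then 1 else 0) * f B)"
      by (rule sum.mono_neutral_right) (auto simp: finite_mset_splits split: if_splits)
    then show "(\<Sum>(A, B)\<in>{(A, B). A + B = M}. (if A = {#} then 1 else 0) * f B) = f M"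
      by simp
  qed
  show "(a + b) * c = a * c + b * c"
    by transfer (simp add: algebra_simps split_def sum.distrib)
  show "a * b * c = a * (b * c)"
  proof (transfer, rule ext)
    fix f g h :: "'a multiset \<Rightarrow> 'b" and M
    define D where "D = (\<lambda>M :: 'a multiset. {(A, B). A + B = M})"
    have fin: "finite (D N)" for N by (simp add: D_def finite_mset_splits)
    have "(\<Sum>(A, C)\<in>D M. (\<Sum>(A, B)\<in>D A. f A * g B) * h C) =
        (\<Sum>p\<in>D M. \<Sum>q\<in>D (fst p). f (fst q) * g (snd q) * h (snd p))"
      by (simp add: split_def sum_distrib_right)
    also have "\<dots> = (\<Sum>(p, q)\<in>(SIGMA p:D M. D (fst p)). f (fst q) * g (snd q) * h (snd p))"
      by (rule sum.Sigma) (auto simp: fin)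
    also have "\<dots> = (\<Sum>(p, q)\<in>(SIGMA p:D M. D (snd p)). f (fst p) * (g (fst q) * h (snd q)))"
      by (rule sum.reindex_bij_witness
          [where j = "\<lambda>((X, C), (A, B)). ((A, B + C), (B, C))"
             and i = "\<lambda>((A, Y), (B, C)). ((A + B, C), (A, B))"])
        (auto simp: D_def ac_simps)
    also have "\<dots> = (\<Sum>p\<in>D M. \<Sum>q\<in>D (snd p). f (fst p) * (g (fst q) * h (snd q)))"
      by (rule sum.Sigma[symmetric]) (auto simp: fin)
    also have "\<dots> = (\<Sum>(A, C)\<in>D M. f A * (\<Sum>(B, C')\<in>D C. g B * h C'))"
      by (simp add: split_def sum_distrib_left)
    finally show "(\<Sum>(A, C)\<in>{(A, C). A + C = M}.
          (\<Sum>(A, B)\<in>{(A', B). A' + B = A}. f A * g B) * h C) =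
        (\<Sum>(A, C)\<in>{(A, C). A + C = M}.
          f A * (\<Sum>(B, C')\<in>{(B, C'). B + C' = C}. g B * h C'))"
      by (simp only: D_def)
  qed
qed

end

definition mfps_monom :: "'v multiset \<Rightarrow> 'a \<Rightarrow> ('v, 'a :: comm_ring_1) mfps" where
  "mfps_monom M c = Abs_mfps (\<lambda>N. if N = M then c else 0)"

abbreviation mfps_const :: "'a \<Rightarrow> ('v, 'a :: comm_ring_1) mfps" where
  "mfps_const c \<equiv> mfps_monom {#} c"

text \<open>
  Infinite sums and products converge coefficientwise: the coefficient of each monomial is the
  value at which the coefficients of the finite partial sums (products) stabilise.
\<close>

definition mfps_infsum :: "('i \<Rightarrow> ('v, 'a) mfps) \<Rightarrow> 'i set \<Rightarrow> ('v, 'a :: comm_ring_1) mfps" where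
  "mfps_infsum F I = Abs_mfps (\<lambda>M. THE c.
     eventually (\<lambda>J. mcoeff (\<Sum>i\<in>J. F i) M = c) (finite_subsets_at_top I))"

definition mfps_infprod :: "('i \<Rightarrow> ('v, 'a) mfps) \<Rightarrow> 'i set \<Rightarrow> ('v, 'a :: comm_ring_1) mfps" where
  "mfps_infprod F I = Abs_mfps (\<lambda>M. THE c.
     eventually (\<lambda>J. mcoeff (\<Prod>i\<in>J. F i) M = c) (finite_subsets_at_top I))"


section \<open>Symmetric functions over the complex numbers\<close>

text \<open>
  Integer partitions are multisets of positive integers. Symmetric functions live in the ring of
  formal power series in the variables indexed by the natural numbers; the ring of symmetric
  functions is the span there of any of the families \<open>m_sym\<close>, \<open>h_part\<close> and \<open>p_part\<close>,
  which are bases of it.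
\<close>

type_synonym symfun = "(nat, complex) mfps"

definition is_partition :: "nat multiset \<Rightarrow> bool" where
  "is_partition l \<longleftrightarrow> 0 \<notin># l"

definition partition_of :: "nat \<Rightarrow> nat multiset \<Rightarrow> bool" where
  "partition_of n l \<longleftrightarrow> is_partition l \<and> sum_mset l = n"

definition exponents :: "'v multiset \<Rightarrow> nat multiset" where
  "exponents M = image_mset (count M) (mset_set (set_mset M))"

definition m_sym :: "nat multiset \<Rightarrow> symfun" where
  "m_sym l = Abs_mfps (\<lambda>M. if exponents M = l then 1 else 0)"

definition h_sym :: "nat \<Rightarrow> symfun" where
  "h_sym n = Abs_mfps (\<lambda>M. if size M = n then 1 else 0)"

definition p_sym :: "nat \<Rightarrow> symfun" where
  "p_sym k = Abs_mfps (\<lambda>M. if \<exists>i. M = replicate_mset k i then 1 else 0)"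

definition h_part :: "nat multiset \<Rightarrow> symfun" where
  "h_part l = (\<Prod>k\<in>#l. h_sym k)"

definition p_part :: "nat multiset \<Rightarrow> symfun" where
  "p_part l = (\<Prod>k\<in>#l. p_sym k)"

definition sym_coords :: "(nat multiset \<Rightarrow> symfun) \<Rightarrow> symfun \<Rightarrow> nat multiset \<Rightarrow> complex" where
  "sym_coords b f = (THE c. finite {l. c l \<noteq> 0} \<and> (\<forall>l. c l \<noteq> 0 \<longrightarrow> is_partition l) \<and>
     f = (\<Sum>l | c l \<noteq> 0. mfps_const (c l) * b l))"

text \<open>The Hall inner product is the bilinear form for which \<open>h_part\<close> and \<open>m_sym\<close> are dual.\<close>

definition hall :: "symfun \<Rightarrow> symfun \<Rightarrow> complex" where
  "hall f g = (\<Sum>l | sym_coords h_part f l \<noteq> 0. sym_coords h_part f l * sym_coords m_sym g l)"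

text \<open>
  \<open>adams k g\<close> is the plethysm of \<open>p_sym k\<close> with \<open>g\<close>, that is, the series
  \<open>g(x_0^k, x_1^k, \<dots>)\<close> (scalars are not affected), for positive \<open>k\<close>.
  For fixed \<open>g\<close>, plethysm is the algebra homomorphism in \<open>f\<close> that extends this.
\<close>

definition adams :: "nat \<Rightarrow> symfun \<Rightarrow> symfun" where
  "adams k g = Abs_mfps (\<lambda>M. \<Sum>N | repeat_mset k N = M. mcoeff g N)"

definition plethysm :: "symfun \<Rightarrow> symfun \<Rightarrow> symfun" where
  "plethysm f g = (\<Sum>l | sym_coords p_part f l \<noteq> 0.
     mfps_const (sym_coords p_part f l) * (\<Prod>k\<in>#l. adams k g))"


section \<open>Frobenius characteristic\<close>

definition cycle_type :: "nat \<Rightarrow> (nat \<Rightarrow> nat) \<Rightarrow> nat multiset" where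
  "cycle_type n s = image_mset card (mset_set (orbit s ` {1..n}))"

text \<open>
  A representation of the symmetric group on \<open>{1..n}\<close> enters through its character.
\<close>

definition frobenius_ch :: "nat \<Rightarrow> ((nat \<Rightarrow> nat) \<Rightarrow> complex) \<Rightarrow> symfun" where
  "frobenius_ch n \<chi> = mfps_const (1 / fact n) *
     (\<Sum>s | s permutes {1..n}. mfps_const (\<chi> s) * p_part (cycle_type n s))"


section \<open>Reduced homology of order complexes\<close>

text \<open>
  For a partial order \<open>le\<close> on a finite set \<open>X\<close>, the faces of the order complex are the chains.
  They are graded here by cardinality, so that \<open>q\<close> stands for homological degree \<open>q - 1\<close>; the
  empty chain (degree \<open>-1\<close>) is a face, which makes the homology reduced.
  A simplicial chain is its coefficient function on faces.
\<close>

definition order_faces :: "'a set \<Rightarrow> ('a \<Rightarrow> 'a \<Rightarrow> bool) \<Rightarrow> nat \<Rightarrow> 'a set set" where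
  "order_faces X le q =
     {S. S \<subseteq> X \<and> finite S \<and> card S = q \<and> (\<forall>a\<in>S. \<forall>b\<in>S. le a b \<or> le b a)}"

definition order_chains :: "'a set \<Rightarrow> ('a \<Rightarrow> 'a \<Rightarrow> bool) \<Rightarrow> nat \<Rightarrow> ('a set \<Rightarrow> complex) set" where
  "order_chains X le q = {c. \<forall>S. S \<notin> order_faces X le q \<longrightarrow> c S = 0}"

text \<open>
  The coefficient at \<open>T\<close> of the boundary of \<open>c\<close>: the face \<open>T\<close> of \<open>insert x T\<close> arises by removing
  \<open>x\<close>, whose position (counted from \<open>0\<close>) is the number of elements of \<open>T\<close> below \<open>x\<close>.
\<close>

definition order_boundary ::
    "'a set \<Rightarrow> ('a \<Rightarrow> 'a \<Rightarrow> bool) \<Rightarrow> ('a set \<Rightarrow> complex) \<Rightarrow> 'a set \<Rightarrow> complex" where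
  "order_boundary X le c = (\<lambda>T. \<Sum>x\<in>X - T. (- 1) ^ card {y\<in>T. le y x} * c (insert x T))"

definition order_cycles :: "'a set \<Rightarrow> ('a \<Rightarrow> 'a \<Rightarrow> bool) \<Rightarrow> nat \<Rightarrow> ('a set \<Rightarrow> complex) set" where
  "order_cycles X le q = {c \<in> order_chains X le q. order_boundary X le c = (\<lambda>_. 0)}"

definition order_boundaries :: "'a set \<Rightarrow> ('a \<Rightarrow> 'a \<Rightarrow> bool) \<Rightarrow> nat \<Rightarrow> ('a set \<Rightarrow> complex) set" where
  "order_boundaries X le q = order_boundary X le ` order_chains X le (Suc q)"

text \<open>
  Trace of the endomorphism induced by \<open>f\<close> on the finite-dimensional quotient \<open>Z / B\<close> of two
  spaces of functions: \<open>S\<close> consists of representatives of the members of a basis of the quotient.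
\<close>

definition quot_basis ::
    "('b \<Rightarrow> complex) set \<Rightarrow> ('b \<Rightarrow> complex) set \<Rightarrow> ('b \<Rightarrow> complex) set \<Rightarrow> bool" where
  "quot_basis Z B S \<longleftrightarrow> finite S \<and> S \<subseteq> Z \<and>
     (\<forall>z\<in>Z. \<exists>!a. (\<forall>s. s \<notin> S \<longrightarrow> a s = 0) \<and> (\<lambda>x. z x - (\<Sum>s\<in>S. a s * s x)) \<in> B)"

definition quot_coords ::
    "('b \<Rightarrow> complex) set \<Rightarrow> ('b \<Rightarrow> complex) set \<Rightarrow> ('b \<Rightarrow> complex) \<Rightarrow> ('b \<Rightarrow> complex) \<Rightarrow> complex" where
  "quot_coords B S z =
     (THE a. (\<forall>s. s \<notin> S \<longrightarrow> a s = 0) \<and> (\<lambda>x. z x - (\<Sum>s\<in>S. a s * s x)) \<in> B)"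

definition quot_trace ::
    "('b \<Rightarrow> complex) set \<Rightarrow> ('b \<Rightarrow> complex) set \<Rightarrow> (('b \<Rightarrow> complex) \<Rightarrow> ('b \<Rightarrow> complex)) \<Rightarrow> complex" where
  "quot_trace Z B f = (let S = SOME S. quot_basis Z B S in \<Sum>s\<in>S. quot_coords B S (f s) s)"


section \<open>The partition lattice and the symmetric functions \<open>L\<close>\<close>

definition proper_set_partitions :: "nat \<Rightarrow> nat set set set" where
  "proper_set_partitions m =
     {P. partition_on {1..m} P} - {(\<lambda>i. {i}) ` {1..m}, {{1..m}}}"

text \<open>
  The action of a permutation \<open>s\<close> on simplicial chains, extending \<open>S \<mapsto> s S\<close> linearly: the
  coefficient at \<open>S\<close> of the translate is the old coefficient at the preimage of \<open>S\<close>.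
\<close>

definition perm_act ::
    "(nat \<Rightarrow> nat) \<Rightarrow> (nat set set set \<Rightarrow> complex) \<Rightarrow> nat set set set \<Rightarrow> complex" where
  "perm_act s c = (\<lambda>S. c ((\<lambda>P. (`) s ` P) -` S))"

text \<open>
  Character of the top reduced homology (degree \<open>m - 3\<close>, chains with \<open>m - 2\<close> elements) of the
  partition lattice, by convention trivial for \<open>m \<le> 2\<close>.
\<close>

definition partition_homology_char :: "nat \<Rightarrow> (nat \<Rightarrow> nat) \<Rightarrow> complex" where
  "partition_homology_char m s =
     (if m \<le> 2 then 1
      else quot_trace
        (order_cycles (proper_set_partitions m) (refines {1..m}) (m - 2))
        (order_boundaries (proper_set_partitions m) (refines {1..m}) (m - 2))
        (perm_act s))"

definition L_sym :: "nat \<Rightarrow> symfun" where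
  "L_sym m = frobenius_ch m (\<lambda>s. partition_homology_char m s * of_int (sign s))"

definition L_part :: "nat multiset \<Rightarrow> symfun" where
  "L_part r = (\<Prod>i\<in>set_mset r. plethysm (h_sym (count r i)) (L_sym i))"


section \<open>Lyndon words\<close>

definition lyndon :: "nat list \<Rightarrow> bool" where
  "lyndon w \<longleftrightarrow> w \<noteq> [] \<and> 0 \<notin> set w \<and>
     (\<forall>k. 0 < k \<and> k < length w \<longrightarrow> (w, rotate k w) \<in> lexord less_than)"

definition lyndon_factorization :: "nat list \<Rightarrow> nat list list" where
  "lyndon_factorization a = (THE ws. concat ws = a \<and> (\<forall>w\<in>set ws. lyndon w) \<and>
     sorted_wrt (\<lambda>u v. v = u \<or> (v, u) \<in> lexord less_than) ws)"

definition lyndon_type :: "nat list \<Rightarrow> nat multiset" where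
  "lyndon_type a = mset (map sum_list (lyndon_factorization a))"


section \<open>The generating function\<close>

datatype yz_var = Y nat | Z nat

definition yz_monomial :: "nat multiset \<Rightarrow> nat multiset \<Rightarrow> yz_var multiset" where
  "yz_monomial a b = image_mset Y a + image_mset Z b"

definition lyndon_factor :: "nat list \<Rightarrow> (yz_var, symfun) mfps" where
  "lyndon_factor w = mfps_infsum
     (\<lambda>r. mfps_monom
        (yz_monomial (image_mset (\<lambda>i. i * sum_list w) r)
                     (mset (concat (replicate (sum_mset r) w))))
        (plethysm (L_part r) (h_part (mset w))))
     {r. is_partition r}"

end

(*
  Since h_n is dual to m_(n), pairing with h_n reads off the coefficient of x_0^n, so only the
  one-variable specialisation of the product matters, and it is a ring homomorphism. It sends h_w
  to x^|w|, L_1 to x, and L_m to 0 for m >= 2: every maximal chain of proper partitions is fixed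
  by a transposition swapping two elements of a block of its finest member, hence the
  antisymmetrizer kills the top chains and the sign character does not occur in the top homology.
  So only rho = 1^k survives in the factor of w, which becomes the geometric series of
  y_|w| z_w x^|w|, and the coefficient counts multisets of Lyndon words. By unique factorization
  into decreasing Lyndon words (the last factor is the least nonempty suffix) these are the words
  of the right content and type.
*)
theory Submission
  imports Defs "HOL-Library.List_Lexorder" "HOL-Computational_Algebra.Formal_Power_Series"
begin

section \<open>Lyndon factorization\<close>

text \<open>Much of the work goes into making the defined objects mean something.
  \<open>sym_coords\<close>, and through it \<open>plethysm\<close> and \<open>hall\<close>, is a
  \<open>THE\<close>: it has its intended value only once the family concerned is linearly
  independent and the argument has coordinates. \<open>p_filtration 0\<close>, the span of all
  \<open>p_part l\<close>, serves as the ring of symmetric functions: it is closed under the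
  operations that occur, and each series fed to \<open>plethysm\<close> or \<open>hall\<close> is
  shown to lie in it. Independence of \<open>p_part\<close> and \<open>m_sym\<close> is
  triangularity on monomials; that of \<open>h_part\<close> is transferred from
  \<open>p_part\<close> by counting parts. Likewise \<open>quot_trace\<close> chooses a basis, whose
  existence is proved for quotients of spaces supported on a finite set. The sign multiplicity
  enters because every \<open>p_part l\<close> with l of sum n specialises to x^n, so that a
  Frobenius characteristic becomes the average of its character times x^n. Power sums are also the
  reason why specialisation is compatible with plethysm by a series that becomes x^d or 0. The
  infinite product converges because the factor of w differs from 1 only at monomials divisible by
  z_w.\<close>

lemma lexord_less_than_iff [simp]: "(u, v) \<in> lexord less_than \<longleftrightarrow> u < (v :: nat list)"
  by (simp add: list_less_def less_than_def less_eq pred_nat_trancl_eq_le lexord_def)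

lemma list_less_append_left [simp]: "u @ v < u @ w \<longleftrightarrow> v < (w :: nat list)"
  by (induction u) simp_all

lemma list_le_append [simp]: "u \<le> u @ (v :: nat list)"
  by (induction u) simp_all

lemma list_less_append_same_length:
  "length u = length v \<Longrightarrow> u @ x < v @ y \<longleftrightarrow> u < v \<or> u = v \<and> x < (y :: nat list)"
  by (induction u v rule: list_induct2) auto

text \<open>Neither word is a prefix of the other, so they already differ at a position present in
  both, and nothing appended can change the comparison.\<close>

lemma list_less_appendI:
  "u < v \<Longrightarrow> \<not> (\<exists>t. v = u @ t) \<Longrightarrow> u @ x < v @ (y :: nat list)"
proof (induction u arbitrary: v)
  case Nil
  then show ?case by simp
next
  case (Cons a u)
  then show ?case by (cases v) auto
qed

text \<open>Passing from rotations to suffixes: suppose a proper suffix \<open>v\<close> of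
  \<open>w = u @ v\<close> is smaller than \<open>w\<close>. If \<open>v\<close> is also a prefix,
  \<open>w = v @ t\<close> with \<open>t\<close> as long as \<open>u\<close>, then the rotation
  \<open>t @ v\<close> gives \<open>u < t\<close> while the rotation \<open>v @ u\<close> gives
  \<open>t < u\<close>. If not, the difference lies within \<open>v\<close> and already makes
  \<open>v @ u\<close> smaller than \<open>w\<close>. The converse holds because
  \<open>v \<le> v @ u\<close>.\<close>

lemma lyndon_iff_suffix:
  "lyndon w \<longleftrightarrow> w \<noteq> [] \<and> 0 \<notin> set w \<and>
     (\<forall>u v. w = u @ v \<longrightarrow> u \<noteq> [] \<longrightarrow> v \<noteq> [] \<longrightarrow> w < v)"
proof -
  have rot: "(\<forall>k. 0 < k \<and> k < length w \<longrightarrow> w < rotate k w) \<longleftrightarrow>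
      (\<forall>u v. w = u @ v \<longrightarrow> u \<noteq> [] \<longrightarrow> v \<noteq> [] \<longrightarrow> w < v @ u)" (is "?l \<longleftrightarrow> ?r")
  proof
    assume l: ?l
    show ?r
    proof (intro allI impI)
      fix u v assume "w = u @ v" "u \<noteq> []" "v \<noteq> []"
      then show "w < v @ u"
        using l[rule_format, of "length u"] by (simp add: rotate_append)
    qed
  next
    assume r: ?r
    show ?l
    proof (intro allI impI)
      fix k assume "0 < k \<and> k < length w"
      then show "w < rotate k w"
        using r[rule_format, of "take k w" "drop k w"] by (cases w) (auto simp: rotate_drop_take)
    qed
  qed
  have "?thesis" if pos: "w \<noteq> []"
  proof -
    have "(\<forall>u v. w = u @ v \<longrightarrow> u \<noteq> [] \<longrightarrow> v \<noteq> [] \<longrightarrow> w < v @ u) \<longleftrightarrow>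
      (\<forall>u v. w = u @ v \<longrightarrow> u \<noteq> [] \<longrightarrow> v \<noteq> [] \<longrightarrow> w < v)" (is "?l \<longleftrightarrow> ?r")
    proof
      assume ?r
      then show ?l using list_le_append order.strict_trans2 by blast
    next
      assume l: ?l
      show ?r
      proof (intro allI impI)
        fix u v assume w: "w = u @ v" and u: "u \<noteq> []" and v: "v \<noteq> []"
        show "w < v"
        proof (rule ccontr)
          assume "\<not> w < v"
          moreover have "w \<noteq> v" using w u by simp
          ultimately have less: "v < w" by simp
          show False
          proof (cases "\<exists>t. w = v @ t")
            case True
            then obtain t where t: "w = v @ t" by blast
            have len: "length t = length u" using w t by (metis add_diff_cancel_left' add_diff_cancel_right' length_append)
            then have "t \<noteq> []" using u by auto
            then have "u @ v < t @ v" using l t v w by metis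
            then have "u < t" using len by (simp add: list_less_append_same_length)
            moreover have "v @ t < v @ u" using l t u v w by metis
            ultimately show False by simp
          next
            case False
            from list_less_appendI[OF less this, of u "[]"] have "v @ u < w" by simp
            moreover have "w < v @ u" using l u v w by blast
            ultimately show False by simp
          qed
        qed
      qed
    qed
    then show ?thesis using pos rot by (simp add: lyndon_def)
  qed
  then show ?thesis by (auto simp: lyndon_def)
qed

lemma lyndon_suffix_le:
  assumes "lyndon (u @ v)" "v \<noteq> []"
  shows "u @ v \<le> v"
  using assms by (cases "u = []") (auto simp: lyndon_iff_suffix intro: less_imp_le)

text \<open>The suffix \<open>v\<close> starts inside some factor \<open>w\<close>, with a nonempty
  suffix \<open>t\<close> of it. Then \<open>x \<le> w \<le> t \<le> v\<close>: by the order of the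
  factors, by the suffix property of \<open>w\<close>, and because \<open>t\<close> is a prefix of
  \<open>v\<close>.\<close>

lemma lyndon_factorization_last_le:
  assumes "\<forall>w\<in>set (ws @ [x]). lyndon w" "sorted_wrt (\<ge>) (ws @ [x])"
    and "concat (ws @ [x]) = u @ v" "v \<noteq> []"
  shows "x \<le> v"
  using assms
proof (induction ws arbitrary: u)
  case Nil
  then show ?case using lyndon_suffix_le by simp
next
  case (Cons w ws)
  from Cons.prems(3) obtain t where
    "w = u @ t \<and> t @ concat (ws @ [x]) = v \<or> w @ t = u \<and> concat (ws @ [x]) = t @ v"
    by (auto simp: append_eq_append_conv2)
  then show ?case
  proof
    assume *: "w = u @ t \<and> t @ concat (ws @ [x]) = v"
    show ?thesis
    proof (cases "t = []")
      case True
      then show ?thesis using Cons.IH[of "[]"] Cons.prems * by simp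
    next
      case False
      have "x \<le> w" using Cons.prems by simp
      also have "w \<le> t" using lyndon_suffix_le[of u t] Cons.prems * False by simp
      also have "t \<le> v" using * list_le_append by blast
      finally show ?thesis .
    qed
  next
    assume "w @ t = u \<and> concat (ws @ [x]) = t @ v"
    then show ?thesis using Cons by auto
  qed
qed

definition lyndon_factors :: "nat list \<Rightarrow> nat list list \<Rightarrow> bool" where
  "lyndon_factors a ws \<longleftrightarrow> concat ws = a \<and> (\<forall>w\<in>set ws. lyndon w) \<and> sorted_wrt (\<ge>) ws"

text \<open>The last factor of either factorization is a nonempty suffix of the common word, so each
  is at most the other; they agree and can be cancelled.\<close>

lemma lyndon_factors_unique:
  "lyndon_factors a ws \<Longrightarrow> lyndon_factors a vs \<Longrightarrow> ws = vs"
proof (induction ws arbitrary: a vs rule: rev_induct)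
  case Nil
  then show ?case by (cases vs) (auto simp: lyndon_factors_def lyndon_def)
next
  case (snoc w ws)
  have "w \<noteq> []" using snoc.prems by (auto simp: lyndon_factors_def lyndon_def)
  then have "vs \<noteq> []" using snoc.prems by (auto simp: lyndon_factors_def)
  then obtain us v where vs: "vs = us @ [v]" by (meson rev_exhaust)
  have "v \<noteq> []" using snoc.prems vs by (auto simp: lyndon_factors_def lyndon_def)
  have "w \<le> v" using snoc.prems vs \<open>v \<noteq> []\<close>
    by (intro lyndon_factorization_last_le[of ws w "concat us" v]) (auto simp: lyndon_factors_def)
  moreover have "v \<le> w" using snoc.prems vs \<open>w \<noteq> []\<close>
    by (intro lyndon_factorization_last_le[of us v "concat ws" w]) (auto simp: lyndon_factors_def)
  ultimately have "v = w" by simp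
  then have "ws = us" using snoc.prems vs
    by (intro snoc.IH[of "concat ws"]) (auto simp: lyndon_factors_def sorted_wrt_append)
  then show ?case using vs \<open>v = w\<close> by simp
qed

text \<open>The least nonempty suffix \<open>s\<close> is split off. It is Lyndon because its own
  suffixes are suffixes of the whole word; the rest is factored by induction on the length.\<close>

lemma lyndon_factors_exists:
  "0 \<notin> set a \<Longrightarrow> \<exists>ws. lyndon_factors a ws"
proof (induction "length a" arbitrary: a rule: less_induct)
  case less
  show ?case
  proof (cases "a = []")
    case True
    then show ?thesis by (intro exI[of _ "[]"]) (simp add: lyndon_factors_def)
  next
    case False
    define T where "T = {v. v \<noteq> [] \<and> (\<exists>u. a = u @ v)}"
    have "T \<subseteq> (\<lambda>k. drop k a) ` {..length a}"
    proof
      fix v assume "v \<in> T"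
      then obtain u where "a = u @ v" by (auto simp: T_def)
      then show "v \<in> (\<lambda>k. drop k a) ` {..length a}"
        by (intro image_eqI[of _ _ "length u"]) auto
    qed
    then have fin: "finite T" by (rule finite_subset) simp
    have ne: "T \<noteq> {}" using False by (auto simp: T_def)
    define s where "s = Min T"
    have sT: "s \<in> T" unfolding s_def by (rule Min_in[OF fin ne])
    have s_le: "s \<le> v" if "v \<in> T" for v unfolding s_def by (rule Min_le[OF fin that])
    from sT obtain b where b: "a = b @ s" and "s \<noteq> []" by (auto simp: T_def)
    have lyn: "lyndon s"
      unfolding lyndon_iff_suffix
    proof (intro conjI allI impI)
      show "s \<noteq> []" "0 \<notin> set s" using b \<open>s \<noteq> []\<close> less.prems by auto
      fix u v assume *: "s = u @ v" "u \<noteq> []" "v \<noteq> []"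
      then have "v \<in> T" using b by (auto simp: T_def)
      moreover have "s \<noteq> v" using * by simp
      ultimately show "s < v" using s_le by fastforce
    qed
    obtain ws where ws: "lyndon_factors b ws"
      using less.hyps[of b] less.prems b \<open>s \<noteq> []\<close> by auto
    \<comment> \<open>Only the last factor \<open>x\<close> before \<open>s\<close> matters. If
      \<open>x < s\<close>, compare \<open>s\<close> with the suffix \<open>x @ s\<close>, which is
      at least \<open>s\<close> by minimality. When \<open>x\<close> is not a prefix of
      \<open>s\<close>, this is impossible outright; when \<open>s = x @ t\<close>, cancelling
      \<open>x\<close> gives \<open>t \<le> s\<close>, minimality gives \<open>s \<le> t\<close>,
      and so \<open>x\<close> would be empty.\<close>
    have last: "s \<le> w" if "w \<in> set ws" for w
    proof -
      from that have "ws \<noteq> []" by auto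
      then obtain us x where us: "ws = us @ [x]" by (cases ws rule: rev_cases) auto
      have "s \<le> x"
      proof (rule ccontr)
        assume "\<not> s \<le> x"
        then have xs: "x < s" by simp
        have "x @ s \<in> T" using b ws us \<open>s \<noteq> []\<close> by (auto simp: T_def lyndon_factors_def)
        then have le: "s \<le> x @ s" by (rule s_le)
        show False
        proof (cases "\<exists>t. s = x @ t")
          case False
          then show False using list_less_appendI[OF xs False, of s "[]"] le by simp
        next
          case True
          then obtain t where t: "s = x @ t" by blast
          have "t \<noteq> []" using xs t by auto
          then have "t \<in> T" using b t by (auto simp: T_def)
          then have "s \<le> t" by (rule s_le)
          moreover have "t \<le> s" using le t by (metis list_less_append_left not_less)
          moreover have "x \<noteq> []" using ws us by (auto simp: lyndon_factors_def lyndon_def)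
          ultimately show False using t by (metis antisym append_self_conv2)
        qed
      qed
      moreover have "x \<le> w" using ws us that by (auto simp: lyndon_factors_def sorted_wrt_append)
      ultimately show ?thesis by simp
    qed
    then have "lyndon_factors a (ws @ [s])"
      using ws lyn b by (auto simp: lyndon_factors_def sorted_wrt_append)
    then show ?thesis ..
  qed
qed

lemma lyndon_factorization_eqI: "lyndon_factors a ws \<Longrightarrow> lyndon_factorization a = ws"
proof -
  have "(\<lambda>u v :: nat list. v = u \<or> (v, u) \<in> lexord less_than) = (\<ge>)"
    by (auto simp: fun_eq_iff)
  then have "lyndon_factorization a = (THE ws. lyndon_factors a ws)"
    by (simp only: lyndon_factorization_def lyndon_factors_def)
  then show "lyndon_factors a ws \<Longrightarrow> lyndon_factorization a = ws"
    using lyndon_factors_unique by (auto intro!: the_equality)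
qed

lemma lyndon_factors_factorization:
  "0 \<notin> set a \<Longrightarrow> lyndon_factors a (lyndon_factorization a)"
  using lyndon_factorization_eqI lyndon_factors_exists by metis

text \<open>A multiset of Lyndon words, sorted decreasingly and concatenated, gives a word whose
  factorization is that very list by uniqueness. The absence of zero letters guarantees that every
  word counted on the left has a factorization.\<close>

lemma card_words_eq_card_lyndon_multisets:
  assumes "0 \<notin># \<mu>"
  shows "card {a. mset a = \<mu> \<and> lyndon_type a = lam} =
    card {K. (\<forall>w\<in>#K. lyndon w) \<and> image_mset sum_list K = lam \<and> (\<Sum>w\<in>#K. mset w) = \<mu>}"
    (is "card ?A = card ?B")
proof (rule bij_betw_same_card)
  have fact: "lyndon_factors a (lyndon_factorization a)" if "a \<in> ?A" for a
    using that assms by (intro lyndon_factors_factorization) auto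
  have sum: "(\<Sum>w\<in>#mset ws. mset w) = mset (concat ws)" for ws :: "nat list list"
    by (induction ws) simp_all
  show "bij_betw (\<lambda>a. mset (lyndon_factorization a)) ?A ?B"
  proof (rule bij_betw_byWitness[where f' = "\<lambda>K. concat (rev (sorted_list_of_multiset K))"])
    have "rev (sorted_list_of_multiset (mset ws)) = ws" if "sorted_wrt (\<ge>) ws" for ws :: "nat list list"
    proof -
      have "sorted (rev ws)" using that by (simp add: sorted_wrt_rev)
      then have "sort ws = rev ws" by (intro properties_for_sort) simp_all
      then show ?thesis by simp
    qed
    then show "\<forall>a\<in>?A. concat (rev (sorted_list_of_multiset (mset (lyndon_factorization a)))) = a"
      using fact by (simp add: lyndon_factors_def)
    have *: "lyndon_factorization (concat (rev (sorted_list_of_multiset K))) = rev (sorted_list_of_multiset K)"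
      if "K \<in> ?B" for K
      using that by (intro lyndon_factorization_eqI) (auto simp: lyndon_factors_def sorted_wrt_rev)
    then show "\<forall>K\<in>?B. mset (lyndon_factorization (concat (rev (sorted_list_of_multiset K)))) = K"
      by simp
    show "(\<lambda>a. mset (lyndon_factorization a)) ` ?A \<subseteq> ?B"
    proof (rule image_subsetI)
      fix a assume "a \<in> ?A"
      with fact[OF this] show "mset (lyndon_factorization a) \<in> ?B"
        by (simp only: mem_Collect_eq sum) (auto simp: lyndon_factors_def lyndon_type_def)
    qed
    show "(\<lambda>K. concat (rev (sorted_list_of_multiset K))) ` ?B \<subseteq> ?A"
    proof (rule image_subsetI)
      fix K assume K: "K \<in> ?B"
      have "mset (concat (rev (sorted_list_of_multiset K))) = (\<Sum>w\<in>#K. mset w)"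
        by (subst sum[symmetric]) simp
      then show "concat (rev (sorted_list_of_multiset K)) \<in> ?A"
        using K *[OF K] by (simp add: lyndon_type_def)
    qed
  qed
qed

section \<open>The sign character in the top homology of the partition lattice\<close>

definition fun_subspace :: "('b \<Rightarrow> complex) set \<Rightarrow> bool" where
  "fun_subspace V \<longleftrightarrow> (\<lambda>_. 0) \<in> V \<and> (\<forall>f\<in>V. \<forall>g\<in>V. \<forall>a. (\<lambda>x. f x + a * g x) \<in> V)"

lemma fun_subspace_zero: "fun_subspace V \<Longrightarrow> (\<lambda>_. 0) \<in> V"
  by (simp add: fun_subspace_def)

lemma fun_subspace_add_scale:
  "fun_subspace V \<Longrightarrow> f \<in> V \<Longrightarrow> g \<in> V \<Longrightarrow> (\<lambda>x. f x + a * g x) \<in> V"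
  by (simp add: fun_subspace_def)

lemma fun_subspace_scale: "fun_subspace V \<Longrightarrow> f \<in> V \<Longrightarrow> (\<lambda>x. a * f x) \<in> V"
  using fun_subspace_add_scale[of V "\<lambda>_. 0" f a] by (simp add: fun_subspace_zero)

lemma fun_subspace_diff: "fun_subspace V \<Longrightarrow> f \<in> V \<Longrightarrow> g \<in> V \<Longrightarrow> (\<lambda>x. f x - g x) \<in> V"
  using fun_subspace_add_scale[of V f g "-1"] by simp

lemma fun_subspace_sum:
  assumes V: "fun_subspace V" and "finite I" "\<And>i. i \<in> I \<Longrightarrow> f i \<in> V"
  shows "(\<lambda>x. \<Sum>i\<in>I. t i * f i x) \<in> V"
  using assms(2,3)
proof (induction I rule: finite_induct)
  case empty
  then show ?case using fun_subspace_zero[OF V] by simp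
next
  case (insert i I)
  then have "(\<lambda>x. (\<Sum>i\<in>I. t i * f i x) + t i * f i x) \<in> V"
    by (intro fun_subspace_add_scale[OF V]) auto
  then show ?case using insert by (simp add: add.commute)
qed

lemma fun_subspace_Int: "fun_subspace V \<Longrightarrow> fun_subspace W \<Longrightarrow> fun_subspace (V \<inter> W)"
  by (simp add: fun_subspace_def)

lemma fun_subspace_vanishing: "fun_subspace V \<Longrightarrow> fun_subspace {f \<in> V. f x = 0}"
  by (simp add: fun_subspace_def)

text \<open>Gaussian elimination, one coordinate at a time.\<close>

lemma quot_basis_exists_subset:
  assumes "finite F" "fun_subspace C" "fun_subspace B" "B \<subseteq> C" "\<forall>z\<in>C. \<forall>x. x \<notin> F \<longrightarrow> z x = 0"
  shows "\<exists>S. quot_basis C B S"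
  using assms
proof (induction F arbitrary: C B rule: finite_induct)
  case empty
  have "quot_basis C B {}"
    unfolding quot_basis_def
  proof (intro conjI ballI)
    fix z assume "z \<in> C"
    then have "z = (\<lambda>_. 0)" using empty.prems by auto
    then show "\<exists>!a. (\<forall>s. s \<notin> {} \<longrightarrow> a s = 0) \<and> (\<lambda>x. z x - (\<Sum>s\<in>{}. a s * s x)) \<in> B"
      using fun_subspace_zero[OF empty.prems(2)] by (intro ex1I[of _ "\<lambda>_. 0"]) auto
  qed simp_all
  then show ?case ..
next
  case (insert p F)
  define C' where "C' = {f \<in> C. f p = 0}"
  define B' where "B' = {f \<in> B. f p = 0}"
  have "\<exists>S. quot_basis C' B' S"
  proof (rule insert.IH)
    show "fun_subspace C'" "fun_subspace B'" "B' \<subseteq> C'"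
      using insert.prems fun_subspace_vanishing by (auto simp: C'_def B'_def)
    show "\<forall>z\<in>C'. \<forall>x. x \<notin> F \<longrightarrow> z x = 0"
      using insert.prems by (auto simp: C'_def)
  qed
  then obtain S where S: "quot_basis C' B' S" ..
  then have S': "finite S" "\<And>s. s \<in> S \<Longrightarrow> s \<in> C" "\<And>s. s \<in> S \<Longrightarrow> s p = 0"
    by (auto simp: quot_basis_def C'_def)
  have B'_p: "f p = 0" if "f \<in> B'" for f using that by (simp add: B'_def)
  have Sp: "(\<Sum>s\<in>S. a s * s p) = 0" for a using S'(3) by (intro sum.neutral) auto
  have normalise: "\<exists>g\<in>V. g p = 1" if V: "fun_subspace V" "f \<in> V" "f p \<noteq> 0" for V f
    using fun_subspace_scale[OF V(1,2), of "1 / f p"] V(3) by (intro bexI) auto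
  \<comment> \<open>The pivot at the coordinate \<open>p\<close>. If \<open>B\<close> has a vector
    with entry 1 at \<open>p\<close>, subtracting multiples of it clears \<open>p\<close> without
    leaving the class modulo \<open>B\<close>, and the basis is unchanged. If only \<open>C\<close>
    has one, it becomes a new basis vector, whose coordinate is the entry at \<open>p\<close>.
    Otherwise everything vanishes at \<open>p\<close> already.\<close>
  consider (boundary) b where "b \<in> B" "b p = 1"
    | (cycle) z1 where "z1 \<in> C" "z1 p = 1" "B' = B"
    | (none) "C' = C" "B' = B"
    using normalise[OF insert.prems(1)] normalise[OF insert.prems(2)] insert.prems(3)
    unfolding C'_def B'_def by blast
  then show ?case
  proof cases
    case none
    then show ?thesis using S by auto
  next
    case boundary
    have "\<exists>!a. (\<forall>s. s \<notin> S \<longrightarrow> a s = 0) \<and> (\<lambda>x. z x - (\<Sum>s\<in>S. a s * s x)) \<in> B"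
      if z: "z \<in> C" for z
    proof -
      define z' where "z' = (\<lambda>x. z x + (- z p) * b x)"
      have "z' \<in> C'" using z boundary insert.prems fun_subspace_add_scale[of C z b "- z p"]
        by (auto simp: C'_def z'_def)
      then have "\<exists>!a. (\<forall>s. s \<notin> S \<longrightarrow> a s = 0) \<and> (\<lambda>x. z' x - (\<Sum>s\<in>S. a s * s x)) \<in> B'"
        using S by (simp add: quot_basis_def)
      moreover have "(\<lambda>x. z' x - (\<Sum>s\<in>S. a s * s x)) \<in> B' \<longleftrightarrow>
          (\<lambda>x. z x - (\<Sum>s\<in>S. a s * s x)) \<in> B" for a
      proof
        assume "(\<lambda>x. z' x - (\<Sum>s\<in>S. a s * s x)) \<in> B'"
        then have "(\<lambda>x. z' x - (\<Sum>s\<in>S. a s * s x)) \<in> B" by (simp add: B'_def)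
        from fun_subspace_add_scale[OF insert.prems(2) this boundary(1), of "z p"]
        show "(\<lambda>x. z x - (\<Sum>s\<in>S. a s * s x)) \<in> B" by (simp add: z'_def)
      next
        assume *: "(\<lambda>x. z x - (\<Sum>s\<in>S. a s * s x)) \<in> B"
        have "(\<lambda>x. z' x - (\<Sum>s\<in>S. a s * s x)) =
            (\<lambda>x. z x - (\<Sum>s\<in>S. a s * s x) + - z p * b x)"
          by (simp add: z'_def fun_eq_iff)
        then have "(\<lambda>x. z' x - (\<Sum>s\<in>S. a s * s x)) \<in> B"
          using fun_subspace_add_scale[OF insert.prems(2) * boundary(1), of "- z p"] by metis
        then show "(\<lambda>x. z' x - (\<Sum>s\<in>S. a s * s x)) \<in> B'"
          using boundary(2) Sp[of a] by (simp add: z'_def B'_def)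
      qed
      ultimately show ?thesis by simp
    qed
    then have "quot_basis C B S" using S' by (auto simp: quot_basis_def)
    then show ?thesis ..
  next
    case cycle
    have z1: "z1 \<notin> S" using S'(3)[of z1] cycle(2) by auto
    have "\<exists>!a. (\<forall>s. s \<notin> insert z1 S \<longrightarrow> a s = 0) \<and>
        (\<lambda>x. z x - (\<Sum>s\<in>insert z1 S. a s * s x)) \<in> B"
      if z: "z \<in> C" for z
    proof -
      define z' where "z' = (\<lambda>x. z x + (- z p) * z1 x)"
      have "z' \<in> C'" using z cycle insert.prems fun_subspace_add_scale[of C z z1 "- z p"]
        by (auto simp: C'_def z'_def)
      then have "\<exists>!a. (\<forall>s. s \<notin> S \<longrightarrow> a s = 0) \<and> (\<lambda>x. z' x - (\<Sum>s\<in>S. a s * s x)) \<in> B'"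
        using S by (simp add: quot_basis_def)
      then obtain a where a: "\<forall>s. s \<notin> S \<longrightarrow> a s = 0" "(\<lambda>x. z' x - (\<Sum>s\<in>S. a s * s x)) \<in> B'"
        and a_unique: "\<And>a'. \<forall>s. s \<notin> S \<longrightarrow> a' s = 0 \<Longrightarrow>
          (\<lambda>x. z' x - (\<Sum>s\<in>S. a' s * s x)) \<in> B' \<Longrightarrow> a' = a"
        by (elim ex1E) blast
      have upd: "(\<Sum>s\<in>S. (c(z1 := d)) s * s x) = (\<Sum>s\<in>S. c s * s x)" for c d x
        using z1 by (intro sum.cong) auto
      show ?thesis
      proof (rule ex1I[of _ "a(z1 := z p)"], intro conjI)
        show "\<forall>s. s \<notin> insert z1 S \<longrightarrow> (a(z1 := z p)) s = 0" using a by auto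
        have "(\<lambda>x. z x - (\<Sum>s\<in>insert z1 S. (a(z1 := z p)) s * s x)) =
            (\<lambda>x. z' x - (\<Sum>s\<in>S. a s * s x))"
        proof
          fix x
          show "z x - (\<Sum>s\<in>insert z1 S. (a(z1 := z p)) s * s x) = z' x - (\<Sum>s\<in>S. a s * s x)"
            unfolding sum.insert[OF S'(1) z1] upd by (simp add: z'_def)
        qed
        then show "(\<lambda>x. z x - (\<Sum>s\<in>insert z1 S. (a(z1 := z p)) s * s x)) \<in> B"
          using a(2) cycle(3) by simp
      next
        fix c
        assume c: "(\<forall>s. s \<notin> insert z1 S \<longrightarrow> c s = 0) \<and>
          (\<lambda>x. z x - (\<Sum>s\<in>insert z1 S. c s * s x)) \<in> B"
        then have "(\<lambda>x. z x - (\<Sum>s\<in>insert z1 S. c s * s x)) \<in> B'" using cycle(3) by simp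
        from B'_p[OF this] have "z p - (\<Sum>s\<in>insert z1 S. c s * s p) = 0" .
        then have cz1: "c z1 = z p" using z1 S'(1) Sp cycle by simp
        have "(\<lambda>x. z x - (\<Sum>s\<in>insert z1 S. c s * s x)) =
            (\<lambda>x. z' x - (\<Sum>s\<in>S. (c(z1 := 0)) s * s x))"
        proof
          fix x
          show "z x - (\<Sum>s\<in>insert z1 S. c s * s x) = z' x - (\<Sum>s\<in>S. (c(z1 := 0)) s * s x)"
            unfolding sum.insert[OF S'(1) z1] upd by (simp add: z'_def cz1)
        qed
        then have "(\<lambda>x. z' x - (\<Sum>s\<in>S. (c(z1 := 0)) s * s x)) \<in> B'"
          using c cycle(3) by simp
        then have "c(z1 := 0) = a" using c by (intro a_unique) auto
        then show "c = a(z1 := z p)" using cz1 by auto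
      qed
    qed
    then have "quot_basis C B (insert z1 S)"
      using S' cycle(1) unfolding quot_basis_def by (intro conjI ballI) auto
    then show ?thesis ..
  qed
qed

text \<open>The vectors tested for membership in \<open>B\<close> are combinations of members of
  \<open>C\<close> and so lie in \<open>C\<close>. Hence \<open>B\<close> and
  \<open>B \<inter> C\<close> have the same quotient bases, and the case of an inclusion
  applies.\<close>

lemma quot_basis_exists:
  assumes "finite F" "fun_subspace C" "fun_subspace B" "\<forall>z\<in>C. \<forall>x. x \<notin> F \<longrightarrow> z x = 0"
  shows "\<exists>S. quot_basis C B S"
proof -
  obtain S where S: "quot_basis C (B \<inter> C) S"
    using quot_basis_exists_subset[of F C "B \<inter> C"] assms by (auto intro: fun_subspace_Int)
  have "(\<lambda>x. z x - (\<Sum>s\<in>S. a s * s x)) \<in> C" if "z \<in> C" for z a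
    using S assms(2) that
    by (intro fun_subspace_diff fun_subspace_sum) (auto simp: quot_basis_def)
  then have "quot_basis C B S" using S by (simp add: quot_basis_def)
  then show ?thesis ..
qed

lemma quot_coords_unique:
  assumes "quot_basis C B S" "z \<in> C" "\<forall>s. s \<notin> S \<longrightarrow> a s = 0"
    and "(\<lambda>x. z x - (\<Sum>s\<in>S. a s * s x)) \<in> B"
  shows "quot_coords B S z = a"
proof -
  have "\<exists>!a. (\<forall>s. s \<notin> S \<longrightarrow> a s = 0) \<and> (\<lambda>x. z x - (\<Sum>s\<in>S. a s * s x)) \<in> B"
    using assms by (simp add: quot_basis_def)
  from the1_equality[OF this] assms show ?thesis by (simp add: quot_coords_def)
qed

lemma quot_coords_works:
  assumes "quot_basis C B S" "z \<in> C"
  shows "(\<forall>s. s \<notin> S \<longrightarrow> quot_coords B S z s = 0) \<and>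
    (\<lambda>x. z x - (\<Sum>s\<in>S. quot_coords B S z s * s x)) \<in> B"
proof -
  have "\<exists>!a. (\<forall>s. s \<notin> S \<longrightarrow> a s = 0) \<and> (\<lambda>x. z x - (\<Sum>s\<in>S. a s * s x)) \<in> B"
    using assms by (simp add: quot_basis_def)
  from theI'[OF this] show ?thesis unfolding quot_coords_def .
qed

lemma quot_coords_sum:
  assumes S: "quot_basis C B S" and C: "fun_subspace C" and B: "fun_subspace B"
    and I: "finite I" "\<And>i. i \<in> I \<Longrightarrow> f i \<in> C"
  shows "quot_coords B S (\<lambda>x. \<Sum>i\<in>I. t i * f i x) = (\<lambda>s. \<Sum>i\<in>I. t i * quot_coords B S (f i) s)"
proof (rule quot_coords_unique[OF S])
  show "(\<lambda>x. \<Sum>i\<in>I. t i * f i x) \<in> C"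
    using fun_subspace_sum[OF C I(1), where f = f and t = t] I(2) by simp
  show "\<forall>s. s \<notin> S \<longrightarrow> (\<Sum>i\<in>I. t i * quot_coords B S (f i) s) = 0"
  proof (intro allI impI sum.neutral ballI)
    fix s i assume "s \<notin> S" "i \<in> I"
    then show "t i * quot_coords B S (f i) s = 0" using quot_coords_works[OF S I(2)] by simp
  qed
  have "(\<lambda>x. \<Sum>i\<in>I. t i * (f i x - (\<Sum>s\<in>S. quot_coords B S (f i) s * s x))) \<in> B"
    using I(1) quot_coords_works[OF S I(2)]
    by (intro fun_subspace_sum[OF B, where t = t and f = "\<lambda>i x. f i x - (\<Sum>s\<in>S. quot_coords B S (f i) s * s x)"]) simp_all
  moreover have "(\<Sum>i\<in>I. t i * (\<Sum>s\<in>S. quot_coords B S (f i) s * s x)) =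
      (\<Sum>s\<in>S. (\<Sum>i\<in>I. t i * quot_coords B S (f i) s) * s x)" for x
    by (simp add: sum_distrib_left sum_distrib_right mult.assoc) (rule sum.swap)
  ultimately show "(\<lambda>x. (\<Sum>i\<in>I. t i * f i x) -
      (\<Sum>s\<in>S. (\<Sum>i\<in>I. t i * quot_coords B S (f i) s) * s x)) \<in> B"
    by (simp only: right_diff_distrib sum_subtractf)
qed

text \<open>Linearity of the trace: the \<open>SOME\<close> in \<open>quot_trace\<close> depends on
  \<open>C\<close> and \<open>B\<close> alone, so all operators are traced in the same basis, and
  the weighted sum of traces is the trace of the weighted sum of operators, which is zero on
  \<open>C\<close>.\<close>

lemma quot_trace_sum_eq_0:
  assumes basis: "\<exists>S. quot_basis C B S" and C: "fun_subspace C" and B: "fun_subspace B"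
    and "finite I" and act: "\<And>i z. i \<in> I \<Longrightarrow> z \<in> C \<Longrightarrow> f i z \<in> C"
    and zero: "\<And>z x. z \<in> C \<Longrightarrow> (\<Sum>i\<in>I. t i * f i z x) = 0"
  shows "(\<Sum>i\<in>I. t i * quot_trace C B (f i)) = 0"
proof -
  define S where "S = (SOME S. quot_basis C B S)"
  have S: "quot_basis C B S" unfolding S_def using basis by (rule someI_ex)
  have "(\<Sum>i\<in>I. t i * quot_trace C B (f i)) =
      (\<Sum>i\<in>I. \<Sum>s\<in>S. t i * quot_coords B S (f i s) s)"
    by (simp add: quot_trace_def S_def[symmetric] sum_distrib_left)
  also have "\<dots> = (\<Sum>s\<in>S. \<Sum>i\<in>I. t i * quot_coords B S (f i s) s)" by (rule sum.swap)
  also have "\<dots> = 0"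
  proof (rule sum.neutral, rule ballI)
    fix s assume "s \<in> S"
    then have s: "s \<in> C" using S by (auto simp: quot_basis_def)
    have "(\<lambda>s'. \<Sum>i\<in>I. t i * quot_coords B S (f i s) s') =
        quot_coords B S (\<lambda>x. \<Sum>i\<in>I. t i * f i s x)"
      using act s \<open>finite I\<close> by (intro quot_coords_sum[OF S C B, symmetric]) auto
    also have "\<dots> = quot_coords B S (\<lambda>_. 0)" using zero[OF s] by simp
    also have "\<dots> = (\<lambda>_. 0)"
      using fun_subspace_zero[OF C] fun_subspace_zero[OF B] by (intro quot_coords_unique[OF S]) auto
    finally show "(\<Sum>i\<in>I. t i * quot_coords B S (f i s) s) = 0" by (rule fun_cong)
  qed
  finally show ?thesis .
qed

section \<open>The symmetric group acting on the order complex\<close>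

lemma order_boundary_add_scale:
  "order_boundary X le (\<lambda>S. c S + a * d S) T = order_boundary X le c T + a * order_boundary X le d T"
  by (simp add: order_boundary_def algebra_simps sum.distrib sum_distrib_left)

lemma order_boundary_zero [simp]: "order_boundary X le (\<lambda>_. 0) = (\<lambda>_. 0)"
  by (simp add: order_boundary_def)

lemma fun_subspace_order_cycles: "fun_subspace (order_cycles X le q)"
  by (auto simp: fun_subspace_def order_cycles_def order_chains_def order_boundary_add_scale fun_eq_iff)

lemma fun_subspace_order_boundaries: "fun_subspace (order_boundaries X le q)"
  unfolding fun_subspace_def
proof (intro conjI ballI allI)
  show "(\<lambda>_. 0) \<in> order_boundaries X le q"
    unfolding order_boundaries_def by (rule image_eqI[of _ _ "\<lambda>_. 0"]) (auto simp: order_chains_def)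
  fix f g a assume "f \<in> order_boundaries X le q" "g \<in> order_boundaries X le q"
  then obtain c d where *: "f = order_boundary X le c" "c \<in> order_chains X le (Suc q)"
     "g = order_boundary X le d" "d \<in> order_chains X le (Suc q)"
    by (auto simp: order_boundaries_def)
  then show "(\<lambda>x. f x + a * g x) \<in> order_boundaries X le q"
    unfolding order_boundaries_def
    by (intro image_eqI[of _ _ "\<lambda>S. c S + a * d S"])
      (auto simp: order_chains_def order_boundary_add_scale fun_eq_iff)
qed

definition partition_image :: "(nat \<Rightarrow> nat) \<Rightarrow> nat set set \<Rightarrow> nat set set" where
  "partition_image s P = (`) s ` P"

lemma perm_act_eq: "perm_act s c S = c (partition_image s -` S)"
  by (simp add: perm_act_def partition_image_def[abs_def])

lemma partition_image_compose: "partition_image (s \<circ> t) P = partition_image s (partition_image t P)"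
  by (simp add: partition_image_def image_image image_comp comp_def)

lemma partition_image_id [simp]: "partition_image id P = P"
  by (simp add: partition_image_def)

lemma partition_image_inverse:
  assumes "s permutes A"
  shows "partition_image s (partition_image (inv s) P) = P"
    "partition_image (inv s) (partition_image s P) = P"
  using assms by (simp_all add: partition_image_compose[symmetric] permutes_inv_o)

lemma partition_image_eq_iff:
  "s permutes A \<Longrightarrow> partition_image s P = partition_image s Q \<longleftrightarrow> P = Q"
  by (metis partition_image_inverse(2))

lemma bij_partition_image: "s permutes A \<Longrightarrow> bij (partition_image s)"
  by (rule o_bij[of "partition_image (inv s)"]) (auto simp: fun_eq_iff partition_image_inverse)

lemma partition_on_partition_image:
  assumes "s permutes A" "partition_on A P"
  shows "partition_on A (partition_image s P)"
proof -
  have "(`) s ` P - {{}} = (`) s ` P" using partition_onD3[OF assms(2)] by auto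
  then show ?thesis
    using partition_on_inj_image[OF assms(2), of s] assms(1)
    by (simp add: partition_image_def permutes_image permutes_inj_on)
qed

lemma partition_on_partition_image_iff:
  assumes "s permutes A"
  shows "partition_on A (partition_image s P) \<longleftrightarrow> partition_on A P"
  using partition_on_partition_image[OF assms] partition_on_partition_image[OF permutes_inv[OF assms]]
    partition_image_inverse(2)[OF assms] by metis

lemma refines_partition_image_iff:
  assumes "s permutes A"
  shows "refines A (partition_image s P) (partition_image s Q) \<longleftrightarrow> refines A P Q"
  using permutes_inj[OF assms]
  by (simp add: refines_def partition_on_partition_image_iff[OF assms])
    (simp add: partition_image_def inj_image_subset_iff)

lemma partition_image_proper_iff:
  assumes s: "s permutes {1..m}"
  shows "partition_image s P \<in> proper_set_partitions m \<longleftrightarrow> P \<in> proper_set_partitions m"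
proof -
  have whole: "partition_image s {{1..m}} = {{1..m}}"
    using s by (simp add: partition_image_def permutes_image)
  have "partition_image s ((\<lambda>i. {i}) ` {1..m}) = (\<lambda>i. {i}) ` s ` {1..m}"
    by (simp add: partition_image_def image_image)
  then have singletons: "partition_image s ((\<lambda>i. {i}) ` {1..m}) = (\<lambda>i. {i}) ` {1..m}"
    using s by (simp only: permutes_image)
  show ?thesis
    using partition_image_eq_iff[OF s, of P "{{1..m}}"]
      partition_image_eq_iff[OF s, of P "(\<lambda>i. {i}) ` {1..m}"]
    unfolding whole singletons
    by (simp add: proper_set_partitions_def partition_on_partition_image_iff[OF s] del: One_nat_def)
qed

abbreviation partition_faces :: "nat \<Rightarrow> nat \<Rightarrow> nat set set set set" where
  "partition_faces m \<equiv> order_faces (proper_set_partitions m) (refines {1..m})"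

lemma partition_image_faces:
  assumes s: "s permutes {1..m}" and "S \<in> partition_faces m q"
  shows "partition_image s ` S \<in> partition_faces m q"
proof -
  have "inj_on (partition_image s) S"
    using bij_is_inj[OF bij_partition_image[OF s]] by (rule inj_on_subset) simp
  then have "card (partition_image s ` S) = card S" by (rule card_image)
  then show ?thesis
    using assms(2)
    by (auto simp: order_faces_def image_subset_iff partition_image_proper_iff[OF s]
        refines_partition_image_iff[OF s] simp del: One_nat_def)
qed

lemma perm_act_order_chains:
  assumes s: "s permutes {1..m}"
    and c: "c \<in> order_chains (proper_set_partitions m) (refines {1..m}) q"
  shows "perm_act s c \<in> order_chains (proper_set_partitions m) (refines {1..m}) q"
  unfolding order_chains_def
proof (intro CollectI allI impI)
  fix S assume "S \<notin> partition_faces m q"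
  then have "partition_image s -` S \<notin> partition_faces m q"
    using partition_image_faces[OF s, of "partition_image s -` S"] bij_is_surj[OF bij_partition_image[OF s]]
    by (auto simp: surj_image_vimage_eq)
  then show "perm_act s c S = 0" using c by (simp add: perm_act_eq order_chains_def)
qed

text \<open>Permutations preserve refinement, hence the position of a removed member within its
  chain and with it the sign. The two sides are then one sum, reindexed by the action on set
  partitions.\<close>

lemma order_boundary_perm_act:
  fixes m :: nat
  assumes s: "s permutes {1..m}"
  defines "X \<equiv> proper_set_partitions m" and "le \<equiv> refines {1..m}"
  shows "order_boundary X le (perm_act s c) = perm_act s (order_boundary X le c)"
proof
  fix T
  let ?g = "partition_image s"
  have g: "bij ?g" using s by (rule bij_partition_image)
  have "bij_betw ?g (X - ?g -` T) (X - T)"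
  proof (rule bij_betw_byWitness[where f' = "partition_image (inv s)"])
    show "partition_image (inv s) ` (X - T) \<subseteq> X - ?g -` T"
      using partition_image_inverse[OF s] partition_image_proper_iff[OF permutes_inv[OF s]]
      by (auto simp: X_def)
  qed (use partition_image_inverse[OF s] partition_image_proper_iff[OF s] in \<open>auto simp: X_def\<close>)
  then have "order_boundary X le (perm_act s c) T =
      (\<Sum>x\<in>X - ?g -` T. (- 1) ^ card {y\<in>T. le y (?g x)} * c (?g -` insert (?g x) T))"
    unfolding order_boundary_def perm_act_eq by (rule sum.reindex_bij_betw[symmetric])
  also have "\<dots> = perm_act s (order_boundary X le c) T"
    unfolding perm_act_eq order_boundary_def
  proof (rule sum.cong[OF refl])
    fix x
    have "bij_betw ?g {y \<in> ?g -` T. le y x} {y \<in> T. le y (?g x)}"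
    proof (rule bij_betw_imageI)
      show "inj_on ?g {y \<in> ?g -` T. le y x}" using bij_is_inj[OF g] by (rule inj_on_subset) simp
      show "?g ` {y \<in> ?g -` T. le y x} = {y \<in> T. le y (?g x)}"
      proof (intro equalityI subsetI)
        fix y assume y: "y \<in> {y \<in> T. le y (?g x)}"
        obtain z where "y = ?g z" using bij_is_surj[OF g] by blast
        then show "y \<in> ?g ` {y \<in> ?g -` T. le y x}"
          using y by (auto simp: le_def refines_partition_image_iff[OF s] simp del: One_nat_def)
      qed (auto simp: le_def refines_partition_image_iff[OF s] simp del: One_nat_def)
    qed
    then have "card {y \<in> T. le y (?g x)} = card {y \<in> ?g -` T. le y x}"
      by (rule bij_betw_same_card[symmetric])
    moreover have "?g -` insert (?g x) T = insert x (?g -` T)"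
      using bij_is_inj[OF g] by (auto dest: injD)
    ultimately show "(- 1) ^ card {y\<in>T. le y (?g x)} * c (?g -` insert (?g x) T) =
        (- 1) ^ card {y \<in> ?g -` T. le y x} * c (insert x (?g -` T))"
      by simp
  qed
  finally show "order_boundary X le (perm_act s c) T = perm_act s (order_boundary X le c) T" .
qed

lemma perm_act_order_cycles:
  assumes "s permutes {1..m}"
    and "c \<in> order_cycles (proper_set_partitions m) (refines {1..m}) q"
  shows "perm_act s c \<in> order_cycles (proper_set_partitions m) (refines {1..m}) q"
  using assms perm_act_order_chains[OF assms(1)] order_boundary_perm_act[OF assms(1)]
  by (simp add: order_cycles_def perm_act_eq fun_eq_iff)

text \<open>The transposition swaps two elements of a block of the finest member of the chain.\<close>

lemma face_fixed_by_transposition: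
  assumes S: "S \<in> partition_faces m q" and "q \<noteq> 0"
  obtains a b where "a \<in> {1..m}" "b \<in> {1..m}" "a \<noteq> b"
    "\<And>P. P \<in> S \<Longrightarrow> partition_image (transpose a b) P = P"
proof -
  let ?le = "refines {1..m}"
  from S have fin: "finite S" "S \<noteq> {}" and part: "\<And>P. P \<in> S \<Longrightarrow> partition_on {1..m} P"
    and proper: "\<And>P. P \<in> S \<Longrightarrow> P \<noteq> (\<lambda>i. {i}) ` {1..m}"
    and chain: "\<And>P Q. P \<in> S \<Longrightarrow> Q \<in> S \<Longrightarrow> ?le P Q \<or> ?le Q P"
    using \<open>q \<noteq> 0\<close> by (auto simp: order_faces_def proper_set_partitions_def)
  have "\<exists>P\<in>T. \<forall>Q\<in>T. ?le P Q" if "finite T" "T \<noteq> {}" "T \<subseteq> S" for T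
    using that
  proof (induction T rule: finite_ne_induct)
    case (singleton P)
    then show ?case using chain by auto
  next
    case (insert Q T)
    then obtain P where P: "P \<in> T" "\<forall>Q\<in>T. ?le P Q" by auto
    show ?case
    proof (cases "?le P Q")
      case True
      then show ?thesis using P by auto
    next
      case False
      then have QP: "?le Q P" using chain[of P Q] P insert.prems by auto
      have "?le Q R" if "R \<in> insert Q T" for R
      proof (cases "R = Q")
        case True
        then show ?thesis using chain[of Q Q] insert.prems by auto
      next
        case False
        then show ?thesis using refines_trans[OF QP] P that by auto
      qed
      then show ?thesis by blast
    qed
  qed
  from this[OF fin subset_refl] obtain P where P: "P \<in> S" "\<And>Q. Q \<in> S \<Longrightarrow> ?le P Q" by auto
  have "\<exists>U\<in>P. \<exists>a\<in>U. \<exists>b\<in>U. a \<noteq> b"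
  proof (rule ccontr)
    assume n: "\<not> ?thesis"
    have single: "U = {x}" if "U \<in> P" "x \<in> U" for U x using n that by blast
    have ne: "U \<noteq> {}" if "U \<in> P" for U using partition_onD3[OF part[OF P(1)]] that by blast
    have "U \<in> P \<longleftrightarrow> (\<exists>x\<in>\<Union>P. U = {x})" for U
    proof
      assume "U \<in> P"
      then obtain x where "x \<in> U" using ne by blast
      then show "\<exists>x\<in>\<Union>P. U = {x}" using single[OF \<open>U \<in> P\<close>] \<open>U \<in> P\<close> by blast
    next
      assume "\<exists>x\<in>\<Union>P. U = {x}"
      then obtain x V where "V \<in> P" "x \<in> V" "U = {x}" by blast
      then show "U \<in> P" using single[of V x] by simp
    qed
    then have "P = (\<lambda>i. {i}) ` \<Union>P" by (intro set_eqI) (simp only: image_iff)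
    then have "P = (\<lambda>i. {i}) ` {1..m}" using partition_onD1[OF part[OF P(1)]] by simp
    then show False using proper[OF P(1)] by simp
  qed
  then obtain U a b where U: "U \<in> P" "a \<in> U" "b \<in> U" "a \<noteq> b" by blast
  \<comment> \<open>The least member \<open>P\<close> refines \<open>Q\<close>, so \<open>U\<close>
    lies inside a single block of \<open>Q\<close>. Thus \<open>a\<close> and \<open>b\<close>
    belong to the same blocks of \<open>Q\<close>, and swapping them maps each block to
    itself.\<close>
  have fix_block: "transpose a b ` V = V" if QV: "Q \<in> S" "V \<in> Q" for Q V
  proof -
    have Q: "partition_on {1..m} Q" using part that by simp
    obtain W where W: "W \<in> Q" "U \<subseteq> W" using P(2)[OF QV(1)] U by (auto simp: refines_def)
    have "a \<in> V \<longleftrightarrow> b \<in> V"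
      using partition_onD2[OF Q] W U that(2) by (auto simp: disjoint_def)
    then show ?thesis by (simp add: transpose_image_eq)
  qed
  show thesis
  proof (rule that)
    show "a \<in> {1..m}" "b \<in> {1..m}" using U partition_onD1[OF part[OF P(1)]] by auto
    show "a \<noteq> b" by fact
    show "partition_image (transpose a b) Q = Q" if "Q \<in> S" for Q
      using fix_block[OF that] by (simp add: partition_image_def)
  qed
qed

text \<open>Composition with the transposition permutes the summands and reverses the sign, so the
  sum equals its own negative.\<close>

lemma sum_sign_eq_0:
  fixes f :: "(nat \<Rightarrow> nat) \<Rightarrow> complex"
  assumes ab: "a \<in> A" "b \<in> A" "a \<noteq> b" and f: "\<And>s. s permutes A \<Longrightarrow> f (transpose a b \<circ> s) = f s"
    and "finite A"
  shows "(\<Sum>s | s permutes A. of_int (sign s) * f s) = 0"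
proof -
  let ?t = "transpose a b"
  have t: "?t permutes A" using ab by (simp add: permutes_swap_id)
  have "(\<Sum>s | s permutes A. of_int (sign s) * f s) =
      (\<Sum>s | s permutes A. of_int (sign (?t \<circ> s)) * f (?t \<circ> s))"
    by (rule setum_permutations_compose_left[OF t])
  also have "\<dots> = (\<Sum>s | s permutes A. - (of_int (sign s) * f s))"
  proof (rule sum.cong[OF refl])
    fix s assume "s \<in> {s. s permutes A}"
    then have s: "s permutes A" by simp
    have "sign (?t \<circ> s) = - sign s"
      using s t \<open>finite A\<close> ab by (subst sign_compose) (auto simp: sign_swap_id permutation_permutes)
    then show "of_int (sign (?t \<circ> s)) * f (?t \<circ> s) = - (of_int (sign s) * f s)"
      using f[OF s] by simp
  qed
  finally show ?thesis by (simp add: sum_negf eq_neg_iff_add_eq_0)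
qed

text \<open>The coefficient of \<open>perm_act s z\<close> at \<open>S\<close> sees only the
  preimage of \<open>S\<close> under \<open>s\<close>. Applying after \<open>s\<close> a
  transposition that fixes every member of \<open>S\<close> does not change this preimage, so the
  terms cancel in pairs.\<close>

lemma perm_act_antisymmetrized:
  assumes z: "z \<in> order_chains (proper_set_partitions m) (refines {1..m}) q" and "q \<noteq> 0"
  shows "(\<Sum>s | s permutes {1..m}. of_int (sign s) * perm_act s z S) = 0"
proof (cases "S \<in> partition_faces m q")
  case False
  then have "perm_act s z S = 0" if "s permutes {1..m}" for s
    using perm_act_order_chains[OF that z] by (simp add: order_chains_def)
  then show ?thesis by (intro sum.neutral) simp
next
  case True
  then obtain a b where ab: "a \<in> {1..m}" "b \<in> {1..m}" "a \<noteq> b"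
    and fix': "\<And>P. P \<in> S \<Longrightarrow> partition_image (transpose a b) P = P"
    using face_fixed_by_transposition \<open>q \<noteq> 0\<close> by blast
  let ?t = "transpose a b"
  have t: "?t permutes {1..m}" using ab by (simp add: permutes_swap_id)
  have "partition_image ?t P \<in> S \<longleftrightarrow> P \<in> S" for P
    using fix' partition_image_eq_iff[OF t] by metis
  then have "perm_act (?t \<circ> s) z S = perm_act s z S" for s
    by (simp add: perm_act_eq vimage_def partition_image_compose)
  then show ?thesis using ab by (intro sum_sign_eq_0[of a _ b]) auto
qed

lemma finite_proper_set_partitions: "finite (proper_set_partitions m)"
proof -
  have "proper_set_partitions m \<subseteq> Pow (Pow {1..m})"
    by (auto simp: proper_set_partitions_def partition_on_def)
  then show ?thesis by (rule finite_subset) simp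
qed

text \<open>Divided by \<open>fact m\<close>, this sum is the multiplicity of the sign
  representation in the homology. For \<open>m = 2\<close> the convention makes the character
  constant and the signs cancel. For larger \<open>m\<close> the chains have
  \<open>m - 2 > 0\<close> members, so that a finest member exists.\<close>

lemma sum_sign_partition_homology_char:
  assumes "m \<ge> 2"
  shows "(\<Sum>s | s permutes {1..m}. partition_homology_char m s * of_int (sign s)) = 0"
proof (cases "m = 2")
  case True
  then show ?thesis
    using sum_sign_eq_0[of 1 "{1..m}" 2 "\<lambda>_. 1"] by (simp add: partition_homology_char_def)
next
  case False
  let ?X = "proper_set_partitions m" and ?le = "refines {1..m}"
  have "(\<Sum>s | s permutes {1..m}. of_int (sign s) *
      quot_trace (order_cycles ?X ?le (m - 2)) (order_boundaries ?X ?le (m - 2)) (perm_act s)) = 0"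
  proof (rule quot_trace_sum_eq_0)
    have "finite (partition_faces m (m - 2))"
      by (rule finite_subset[of _ "Pow ?X"])
        (auto simp: order_faces_def finite_proper_set_partitions)
    then show "\<exists>S. quot_basis (order_cycles ?X ?le (m - 2)) (order_boundaries ?X ?le (m - 2)) S"
      by (rule quot_basis_exists[OF _ fun_subspace_order_cycles fun_subspace_order_boundaries])
        (auto simp: order_cycles_def order_chains_def)
  next
    fix z S assume "z \<in> order_cycles ?X ?le (m - 2)"
    then show "(\<Sum>s | s permutes {1..m}. of_int (sign s) * perm_act s z S) = 0"
      using assms False by (intro perm_act_antisymmetrized[of _ _ "m - 2"]) (auto simp: order_cycles_def)
  qed (auto simp: fun_subspace_order_cycles fun_subspace_order_boundaries finite_permutations
      perm_act_order_cycles simp del: One_nat_def)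
  then show ?thesis using assms False by (simp add: partition_homology_char_def mult.commute)
qed

section \<open>Coordinates of symmetric functions\<close>

lemma mcoeff_0 [simp]: "mcoeff 0 M = 0"
  by (simp add: zero_mfps.rep_eq)

lemma mcoeff_1: "mcoeff 1 M = (if M = {#} then 1 else 0)"
  by (simp add: one_mfps.rep_eq)

lemma mcoeff_add [simp]: "mcoeff (f + g) M = mcoeff f M + mcoeff g M"
  by (simp add: plus_mfps.rep_eq)

lemma mcoeff_mult: "mcoeff (f * g) M = (\<Sum>(A, B)\<in>{(A, B). A + B = M}. mcoeff f A * mcoeff g B)"
  by (simp add: times_mfps.rep_eq)

lemma mcoeff_sum [simp]: "mcoeff (sum f I) M = (\<Sum>i\<in>I. mcoeff (f i) M)"
  by (induction I rule: infinite_finite_induct) simp_all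

lemma mcoeff_monom: "mcoeff (mfps_monom M c) N = (if N = M then c else 0)"
  by (simp add: mfps_monom_def)

lemma mcoeff_const_mult [simp]:
  fixes f :: "('v, 'a :: comm_ring_1) mfps"
  shows "mcoeff (mfps_const c * f) M = c * mcoeff f M"
proof -
  have "mcoeff (mfps_const c * f) M =
      (\<Sum>(A, B)\<in>{({#} :: 'v multiset, M)}. mcoeff (mfps_const c) A * mcoeff f B)"
    unfolding mcoeff_mult
    by (rule sum.mono_neutral_right) (auto simp: finite_mset_splits mcoeff_monom split: if_splits)
  then show ?thesis by (simp add: mcoeff_monom)
qed

lemma mfps_const_1 [simp]: "mfps_const 1 = 1"
  by (rule mfps_eqI) (simp add: mcoeff_monom mcoeff_1)

lemma mfps_const_mult: "mfps_const (a * b) = mfps_const a * mfps_const b"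
  by (rule mfps_eqI) (simp add: mcoeff_monom)

text \<open>Scalars act as constant series; this makes spans and induction over them available for
  symmetric functions.\<close>

global_interpretation symfun: vector_space "\<lambda>c (f :: symfun). mfps_const c * f"
  by unfold_locales (auto intro!: mfps_eqI simp: distrib_left distrib_right mult.assoc)

declare symfun.scale_scale [simp del]

lemma symfun_span_mult:
  assumes "f \<in> symfun.span S" "g \<in> symfun.span T"
    and "\<And>u v. u \<in> S \<Longrightarrow> v \<in> T \<Longrightarrow> u * v \<in> symfun.span U"
  shows "f * g \<in> symfun.span U"
  using assms(1)
proof (rule symfun.span_induct)
  show "symfun.subspace {f. f * g \<in> symfun.span U}"
    by (rule symfun.subspaceI)
      (auto simp: distrib_right mult.assoc intro: symfun.span_zero symfun.span_add symfun.span_scale)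
  fix u assume "u \<in> S"
  show "u * g \<in> symfun.span U"
    using assms(2)
  proof (rule symfun.span_induct)
    show "symfun.subspace {g. u * g \<in> symfun.span U}"
      by (rule symfun.subspaceI)
        (auto simp: distrib_left mult.left_commute[of u] intro: symfun.span_zero symfun.span_add symfun.span_scale)
  qed (use assms(3) \<open>u \<in> S\<close> in auto)
qed

text \<open>The condition under the \<open>THE\<close> of \<open>sym_coords\<close>, named so that
  existence (from a span) and uniqueness (from independence) can be treated separately.\<close>

definition is_coords :: "(nat multiset \<Rightarrow> symfun) \<Rightarrow> symfun \<Rightarrow> (nat multiset \<Rightarrow> complex) \<Rightarrow> bool" where
  "is_coords b f c \<longleftrightarrow> finite {l. c l \<noteq> 0} \<and> (\<forall>l. c l \<noteq> 0 \<longrightarrow> is_partition l) \<and>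
     f = (\<Sum>l | c l \<noteq> 0. mfps_const (c l) * b l)"

text \<open>The restriction to partitions is essential: since \<open>h_sym 0 = 1\<close>, adding
  zero parts to an index repeats the same member of \<open>h_part\<close>, and likewise for
  \<open>p_part\<close>.\<close>

definition partition_indep :: "(nat multiset \<Rightarrow> symfun) \<Rightarrow> bool" where
  "partition_indep b \<longleftrightarrow> (\<forall>A c. finite A \<longrightarrow> (\<forall>l\<in>A. is_partition l) \<longrightarrow>
     (\<Sum>l\<in>A. mfps_const (c l) * b l) = 0 \<longrightarrow> (\<forall>l\<in>A. c l = 0))"

lemma is_coords_sum:
  assumes "is_coords b f c" "finite A" "{l. c l \<noteq> 0} \<subseteq> A"
  shows "f = (\<Sum>l\<in>A. mfps_const (c l) * b l)"
proof -
  have "(\<Sum>l | c l \<noteq> 0. mfps_const (c l) * b l) = (\<Sum>l\<in>A. mfps_const (c l) * b l)"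
    using assms by (intro sum.mono_neutral_left) auto
  then show ?thesis using assms(1) by (simp add: is_coords_def)
qed

lemma is_coordsI:
  assumes "finite A" "\<And>l. c l \<noteq> 0 \<Longrightarrow> l \<in> A" "\<And>l. c l \<noteq> 0 \<Longrightarrow> is_partition l"
    and "f = (\<Sum>l\<in>A. mfps_const (c l) * b l)"
  shows "is_coords b f c"
proof -
  have "{l. c l \<noteq> 0} \<subseteq> A" using assms(2) by auto
  moreover have "(\<Sum>l | c l \<noteq> 0. mfps_const (c l) * b l) = (\<Sum>l\<in>A. mfps_const (c l) * b l)"
    using assms(1,2) by (intro sum.mono_neutral_left) auto
  ultimately show ?thesis
    using assms finite_subset by (auto simp: is_coords_def)
qed

lemma is_coords_unique:
  assumes b: "partition_indep b" and c: "is_coords b f c" and d: "is_coords b f d"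
  shows "c = d"
proof -
  define A where "A = {l. c l \<noteq> 0} \<union> {l. d l \<noteq> 0}"
  have A: "finite A" "\<forall>l\<in>A. is_partition l" using c d by (auto simp: A_def is_coords_def)
  have "(\<Sum>l\<in>A. mfps_const (c l - d l) * b l) =
      (\<Sum>l\<in>A. mfps_const (c l) * b l) - (\<Sum>l\<in>A. mfps_const (d l) * b l)"
    by (simp add: symfun.scale_left_diff_distrib sum_subtractf)
  also have "\<dots> = f - f"
    using is_coords_sum[OF c A(1)] is_coords_sum[OF d A(1)] by (simp add: A_def)
  finally have zero: "\<forall>l\<in>A. c l - d l = 0"
    using b[unfolded partition_indep_def, rule_format, OF A(1), of "\<lambda>l. c l - d l"] A(2) by auto
  show ?thesis
  proof
    fix l
    show "c l = d l"
    proof (cases "l \<in> A")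
      case True
      then show ?thesis using bspec[OF zero True] by simp
    qed (simp add: A_def)
  qed
qed

lemma sym_coords_eqI:
  assumes "partition_indep b" "is_coords b f c"
  shows "sym_coords b f = c"
proof -
  have "(THE c. is_coords b f c) = c"
    using assms is_coords_unique by (intro the_equality) blast+
  then show ?thesis by (simp only: sym_coords_def is_coords_def)
qed

lemma is_coords_0: "is_coords b 0 (\<lambda>_. 0)"
  by (simp add: is_coords_def)

lemma is_coords_add:
  assumes c: "is_coords b f c" and d: "is_coords b g d"
  shows "is_coords b (f + g) (\<lambda>l. c l + d l)"
proof (rule is_coordsI)
  let ?A = "{l. c l \<noteq> 0} \<union> {l. d l \<noteq> 0}"
  show fin: "finite ?A" using c d by (simp add: is_coords_def)
  show "f + g = (\<Sum>l\<in>?A. mfps_const (c l + d l) * b l)"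
    using is_coords_sum[OF c fin] is_coords_sum[OF d fin]
    by (simp add: symfun.scale_left_distrib sum.distrib)
  show "is_partition l" if "c l + d l \<noteq> 0" for l
    using that c d by (cases "c l = 0") (auto simp: is_coords_def)
qed auto

lemma is_coords_scale:
  assumes c: "is_coords b f c"
  shows "is_coords b (mfps_const a * f) (\<lambda>l. a * c l)"
proof (rule is_coordsI)
  let ?A = "{l. c l \<noteq> 0}"
  show fin: "finite ?A" using c by (simp add: is_coords_def)
  show "mfps_const a * f = (\<Sum>l\<in>?A. mfps_const (a * c l) * b l)"
    using is_coords_sum[OF c fin] by (simp add: mfps_const_mult sum_distrib_left mult.assoc)
  show "is_partition l" if "a * c l \<noteq> 0" for l
    using that c by (auto simp: is_coords_def)
qed auto

lemma is_coords_single: "is_partition l \<Longrightarrow> is_coords b (b l) (\<lambda>l'. if l' = l then 1 else 0)"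
  by (rule is_coordsI[of "{l}"]) (auto split: if_splits)

text \<open>The set \<open>P\<close> keeps track of the support of the coordinates; it will record a
  lower bound on the number of parts.\<close>

lemma span_imp_is_coords:
  assumes "f \<in> symfun.span (b ` P)" and "\<And>l. l \<in> P \<Longrightarrow> is_partition l"
  shows "\<exists>c. is_coords b f c \<and> (\<forall>l. c l \<noteq> 0 \<longrightarrow> l \<in> P)"
  using assms(1)
proof (rule symfun.span_induct)
  show "symfun.subspace {f. \<exists>c. is_coords b f c \<and> (\<forall>l. c l \<noteq> 0 \<longrightarrow> l \<in> P)}"
  proof (rule symfun.subspaceI; clarify)
    show "\<exists>c. is_coords b 0 c \<and> (\<forall>l. c l \<noteq> 0 \<longrightarrow> l \<in> P)"
      using is_coords_0 by (intro exI[of _ "\<lambda>_. 0"]) simp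
  next
    fix f g c d
    assume *: "is_coords b f c" "\<forall>l. c l \<noteq> 0 \<longrightarrow> l \<in> P" "is_coords b g d" "\<forall>l. d l \<noteq> 0 \<longrightarrow> l \<in> P"
    have "l \<in> P" if "c l + d l \<noteq> 0" for l
      using * that by (cases "c l = 0") auto
    then show "\<exists>c. is_coords b (f + g) c \<and> (\<forall>l. c l \<noteq> 0 \<longrightarrow> l \<in> P)"
      using is_coords_add[OF *(1,3)] by blast
  next
    fix a f c assume *: "is_coords b f c" "\<forall>l. c l \<noteq> 0 \<longrightarrow> l \<in> P"
    then show "\<exists>c. is_coords b (mfps_const a * f) c \<and> (\<forall>l. c l \<noteq> 0 \<longrightarrow> l \<in> P)"
      using is_coords_scale[OF *(1)] by (intro exI[of _ "\<lambda>l. a * c l"]) auto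
  qed
next
  fix f assume "f \<in> b ` P"
  then obtain l where l: "l \<in> P" "f = b l" by auto
  then show "\<exists>c. is_coords b f c \<and> (\<forall>l. c l \<noteq> 0 \<longrightarrow> l \<in> P)"
    using is_coords_single[of l b] assms(2)[OF l(1)]
    by (intro exI[of _ "\<lambda>l'. if l' = l then 1 else 0"]) auto
qed

text \<open>In a vanishing combination take an index \<open>l\<close> of greatest rank with nonzero
  coefficient. The functional \<phi> at \<open>l\<close> annihilates all other terms that occur, so
  the coefficient of \<open>b l\<close> must vanish as well. Linearity is asked only on combinations
  of the family, because coordinate functionals are meaningful only there.\<close>

lemma partition_indep_triangular:
  fixes \<phi> :: "nat multiset \<Rightarrow> symfun \<Rightarrow> complex" and rank :: "nat multiset \<Rightarrow> int"
  assumes linear: "\<And>l A c. finite A \<Longrightarrow> \<forall>l'\<in>A. is_partition l' \<Longrightarrow>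
      \<phi> l (\<Sum>l'\<in>A. mfps_const (c l') * b l') = (\<Sum>l'\<in>A. c l' * \<phi> l (b l'))"
    and diag: "\<And>l. is_partition l \<Longrightarrow> \<phi> l (b l) \<noteq> 0"
    and tri: "\<And>l l'. is_partition l \<Longrightarrow> is_partition l' \<Longrightarrow> \<phi> l (b l') \<noteq> 0 \<Longrightarrow>
      l = l' \<or> rank l < rank l'"
  shows "partition_indep b"
  unfolding partition_indep_def
proof (intro allI impI, rule ccontr)
  fix A c
  assume A: "finite A" "\<forall>l\<in>A. is_partition l"
    and zero: "(\<Sum>l\<in>A. mfps_const (c l) * b l) = 0" and "\<not> (\<forall>l\<in>A. c l = 0)"
  define N where "N = {l \<in> A. c l \<noteq> 0}"
  have N: "finite N" "N \<noteq> {}" using A \<open>\<not> (\<forall>l\<in>A. c l = 0)\<close> by (auto simp: N_def)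
  then have "Max (rank ` N) \<in> rank ` N" by (intro Max_in) auto
  then obtain l where l: "l \<in> N" "rank l = Max (rank ` N)" by auto
  have max: "rank l' \<le> rank l" if "l' \<in> N" for l' using l N that by simp
  have lA: "l \<in> A" "is_partition l" "c l \<noteq> 0" using l A by (auto simp: N_def)
  \<comment> \<open>Linearity is available only for combinations of the family, so the value at 0 is
    obtained from the empty combination.\<close>
  have "0 = \<phi> l (\<Sum>l'\<in>{}. mfps_const (c l') * b l')" by (subst linear) auto
  also have "\<dots> = \<phi> l (\<Sum>l'\<in>A. mfps_const (c l') * b l')" using zero by simp
  also have "\<dots> = (\<Sum>l'\<in>A. c l' * \<phi> l (b l'))" using A by (rule linear)
  also have "\<dots> = (\<Sum>l'\<in>{l}. c l' * \<phi> l (b l'))"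
  proof (rule sum.mono_neutral_right)
    show "\<forall>i\<in>A - {l}. c i * \<phi> l (b i) = 0"
    proof
      fix i assume i: "i \<in> A - {l}"
      show "c i * \<phi> l (b i) = 0"
      proof (cases "c i = 0")
        case False
        then have "rank i \<le> rank l" using i by (intro max) (simp add: N_def)
        then have "\<phi> l (b i) = 0" using tri[of l i] i A lA by force
        then show ?thesis by simp
      qed simp
    qed
  qed (use A lA in auto)
  finally show False using diag[OF lA(2)] lA(3) by simp
qed

section \<open>Monomials of power sum products; independence of \<open>p_part\<close> and
  \<open>m_sym\<close>\<close>

lemma finite_replicate_subsets: "k > 0 \<Longrightarrow> finite {i. k \<le> count M i}"
  by (rule finite_subset[of _ "set_mset M"]) (auto simp: count_inI not_in_iff)

lemma replicate_mset_subset_iff: "replicate_mset k i \<subseteq># M \<longleftrightarrow> k \<le> count M i"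
  by (simp add: count_le_replicate_mset_subset_eq)

text \<open>A splitting of \<open>M\<close> contributes only if its first part is \<open>k\<close>
  copies of a single variable; as \<open>k > 0\<close>, different variables give different
  splittings.\<close>

lemma mcoeff_p_sym_mult:
  assumes "k > 0"
  shows "mcoeff (p_sym k * f) M = (\<Sum>i | k \<le> count M i. mcoeff f (M - replicate_mset k i))"
proof -
  let ?D = "{(A, B). A + B = M}" and ?I = "{i. k \<le> count M i}"
  let ?j = "\<lambda>i. (replicate_mset k i, M - replicate_mset k i)"
  have "mcoeff (p_sym k * f) M = (\<Sum>(A, B)\<in>?j ` ?I. mcoeff (p_sym k) A * mcoeff f B)"
    unfolding mcoeff_mult
  proof (rule sum.mono_neutral_right)
    show "?j ` ?I \<subseteq> ?D"
      by (auto simp: replicate_mset_subset_iff)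
    show "\<forall>p\<in>?D - ?j ` ?I. (case p of (A, B) \<Rightarrow> mcoeff (p_sym k) A * mcoeff f B) = 0"
    proof (rule ballI, rule ccontr)
      fix p assume p: "p \<in> ?D - ?j ` ?I"
        and ne: "(case p of (A, B) \<Rightarrow> mcoeff (p_sym k) A * mcoeff f B) \<noteq> 0"
      then obtain A B where AB: "p = (A, B)" "M = A + B" by auto
      then obtain i where i: "A = replicate_mset k i"
        using ne by (auto simp: p_sym_def split: if_splits)
      then have "p = ?j i" "i \<in> ?I" using AB by auto
      then show False using p by blast
    qed
  qed (simp add: finite_mset_splits)
  also have "\<dots> = (\<Sum>i\<in>?I. mcoeff (p_sym k) (replicate_mset k i) * mcoeff f (M - replicate_mset k i))"
    using assms by (subst sum.reindex) (auto simp: inj_on_def replicate_mset_eq_iff)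
  also have "\<dots> = (\<Sum>i\<in>?I. mcoeff f (M - replicate_mset k i))"
    by (intro sum.cong) (auto simp: p_sym_def)
  finally show ?thesis .
qed

lemma is_partition_exponents: "is_partition (exponents M)"
  by (auto simp: is_partition_def exponents_def simp flip: count_greater_zero_iff)

lemma size_exponents [simp]: "size (exponents M) = card (set_mset M)"
  by (simp add: exponents_def)

lemma exponents_add_replicate:
  assumes "k > 0" "i \<notin># M"
  shows "exponents (replicate_mset k i + M) = add_mset k (exponents M)"
proof -
  have "image_mset (count (replicate_mset k i + M)) (mset_set (set_mset M)) =
      image_mset (count M) (mset_set (set_mset M))"
    using assms by (intro image_mset_cong) auto
  moreover have "set_mset (replicate_mset k i + M) = insert i (set_mset M)"
    using assms by auto
  ultimately show ?thesis
    using assms by (simp add: exponents_def not_in_iff)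
qed

lemma exponents_remove_replicate:
  assumes "k \<in># exponents M"
  obtains i where "count M i = k" "i \<in># M" "exponents (M - replicate_mset k i) = exponents M - {#k#}"
proof -
  obtain i where i: "i \<in># M" "count M i = k" using assms by (auto simp: exponents_def)
  define N where "N = M - replicate_mset k i"
  have M: "M = replicate_mset k i + N"
    using i by (simp add: N_def replicate_mset_subset_iff)
  have "i \<notin># N" using i by (simp add: N_def not_in_iff)
  moreover have "k > 0" using i by auto
  ultimately have "exponents M = add_mset k (exponents N)"
    unfolding M by (intro exponents_add_replicate)
  then show thesis using that i by (simp add: N_def)
qed

text \<open>Supplies, for every partition, a test monomial at which coefficients are read off; each
  new part gets a fresh variable.\<close>

lemma exponents_surj:
  assumes "is_partition l"
  shows "\<exists>M :: nat multiset. exponents M = l"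
  using assms
proof (induction l)
  case empty
  then show ?case by (intro exI[of _ "{#}"]) (simp add: exponents_def)
next
  case (add k l)
  then obtain M :: "nat multiset" where M: "exponents M = l" by (auto simp: is_partition_def)
  obtain i :: nat where "i \<notin># M" using ex_new_if_finite[OF infinite_UNIV_nat, of "set_mset M"] by auto
  then have "exponents (replicate_mset k i + M) = add_mset k l"
    using M add.prems by (subst exponents_add_replicate) (auto simp: is_partition_def)
  then show ?case ..
qed

lemma p_part_add: "p_part (l + l') = p_part l * p_part l'"
  by (simp add: p_part_def)

lemma p_part_add_mset [simp]: "p_part (add_mset k l) = p_sym k * p_part l"
  by (simp add: p_part_def)

lemma p_part_empty [simp]: "p_part {#} = 1"
  by (simp add: p_part_def)

text \<open>A monomial of the product arises by choosing one variable for each part. Distinct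
  choices give exponents \<open>l\<close>; a coincidence leaves fewer variables than parts.\<close>

lemma mcoeff_p_part_triangular:
  assumes "is_partition l" "mcoeff (p_part l) M \<noteq> 0"
  shows "exponents M = l \<or> card (set_mset M) < size l"
  using assms
proof (induction l arbitrary: M)
  case empty
  then show ?case by (auto simp: mcoeff_1 exponents_def split: if_splits)
next
  case (add k l)
  have k: "k > 0" and l: "is_partition l" using add.prems by (auto simp: is_partition_def)
  from add.prems k obtain i where i: "k \<le> count M i"
    and ne: "mcoeff (p_part l) (M - replicate_mset k i) \<noteq> 0"
    by (auto simp: mcoeff_p_sym_mult dest: sum.not_neutral_contains_not_neutral)
  define N where "N = M - replicate_mset k i"
  have M: "M = replicate_mset k i + N" using i by (simp add: N_def replicate_mset_subset_iff)
  have IH: "exponents N = l \<or> card (set_mset N) < size l"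
    using add.IH[OF l ne] by (simp add: N_def)
  show ?case
  proof (cases "i \<in># N")
    case True
    then have "set_mset M = set_mset N" using k by (auto simp: M)
    moreover have "card (set_mset N) \<le> size l"
      using IH by (metis less_imp_le_nat order_refl size_exponents)
    ultimately show ?thesis by simp
  next
    case False
    then have "exponents M = add_mset k (exponents N)" "card (set_mset M) = Suc (card (set_mset N))"
      using k by (simp_all add: M exponents_add_replicate)
    then show ?thesis using IH by auto
  qed
qed

text \<open>Excludes cancellation, so that a single way of producing a monomial suffices for a
  nonzero coefficient. Real parts provide the order on complex coefficients.\<close>

lemma mcoeff_p_part_nonneg:
  "is_partition l \<Longrightarrow> Re (mcoeff (p_part l) M) \<ge> 0"
proof (induction l arbitrary: M)
  case empty
  then show ?case by (simp add: mcoeff_1)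
next
  case (add k l)
  then show ?case by (auto simp: mcoeff_p_sym_mult is_partition_def intro!: sum_nonneg)
qed

lemma mcoeff_p_part_exponents_pos:
  "is_partition l \<Longrightarrow> exponents M = l \<Longrightarrow> Re (mcoeff (p_part l) M) > 0"
proof (induction l arbitrary: M)
  case empty
  then have "M = {#}" by (simp add: exponents_def mset_set_empty_iff)
  then show ?case by (simp add: mcoeff_1)
next
  case (add k l)
  have k: "k > 0" and l: "is_partition l" using add.prems by (auto simp: is_partition_def)
  obtain i where i: "count M i = k" "exponents (M - replicate_mset k i) = l"
    using exponents_remove_replicate[of k M] add.prems(2) by auto
  have "0 < Re (mcoeff (p_part l) (M - replicate_mset k i))" using add.IH[OF l i(2)] .
  also have "\<dots> \<le> (\<Sum>i | k \<le> count M i. Re (mcoeff (p_part l) (M - replicate_mset k i)))"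
    using i k mcoeff_p_part_nonneg[OF l] by (intro member_le_sum) (auto simp: finite_replicate_subsets)
  finally show ?case using k by (simp add: mcoeff_p_sym_mult)
qed

text \<open>The functional reads the coefficient at the test monomial of \<open>l\<close>, which has
  as many variables as \<open>l\<close> has parts; hence the number of parts serves as rank.\<close>

lemma partition_indep_p_part: "partition_indep p_part"
proof -
  obtain \<theta> :: "nat multiset \<Rightarrow> nat multiset" where \<theta>: "\<And>l. is_partition l \<Longrightarrow> exponents (\<theta> l) = l"
    using exponents_surj by metis
  show ?thesis
  proof (rule partition_indep_triangular[where \<phi> = "\<lambda>l f. mcoeff f (\<theta> l)" and rank = "\<lambda>l. int (size l)"])
    fix l :: "nat multiset" assume "is_partition l"
    then show "mcoeff (p_part l) (\<theta> l) \<noteq> 0"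
      using mcoeff_p_part_exponents_pos[of l "\<theta> l"] \<theta> by auto
  next
    fix l l' assume l: "is_partition l" "is_partition l'" "mcoeff (p_part l') (\<theta> l) \<noteq> 0"
    have "card (set_mset (\<theta> l)) = size l" using \<theta>[OF l(1)] by (metis size_exponents)
    then show "l = l' \<or> int (size l) < int (size l')"
      using mcoeff_p_part_triangular[OF l(2,3)] \<theta>[OF l(1)] by auto
  qed simp
qed

lemma partition_indep_m_sym: "partition_indep m_sym"
proof -
  obtain \<theta> :: "nat multiset \<Rightarrow> nat multiset" where \<theta>: "\<And>l. is_partition l \<Longrightarrow> exponents (\<theta> l) = l"
    using exponents_surj by metis
  show ?thesis
    by (rule partition_indep_triangular[where \<phi> = "\<lambda>l f. mcoeff f (\<theta> l)" and rank = "\<lambda>_. 0"])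
      (auto simp: m_sym_def \<theta> split: if_splits)
qed

text \<open>
  Modulo products of more power sums, \<open>h_sym k\<close> is \<open>p_sym k / k\<close>; so \<open>h_part\<close> is triangular
  with respect to \<open>p_part\<close> and inherits its linear independence.
\<close>

definition p_filtration :: "nat \<Rightarrow> symfun set" where
  "p_filtration j = symfun.span (p_part ` {l. is_partition l \<and> size l \<ge> j})"

lemma p_filtration_mono: "i \<le> j \<Longrightarrow> p_filtration j \<subseteq> p_filtration i"
  unfolding p_filtration_def by (intro symfun.span_mono) auto

lemma p_filtration_mult: "f \<in> p_filtration i \<Longrightarrow> g \<in> p_filtration j \<Longrightarrow> f * g \<in> p_filtration (i + j)"
  unfolding p_filtration_def
proof (erule (1) symfun_span_mult)
  fix u v
  assume "u \<in> p_part ` {l. is_partition l \<and> i \<le> size l}" "v \<in> p_part ` {l. is_partition l \<and> j \<le> size l}"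
  then obtain l l' where *: "u = p_part l" "is_partition l" "i \<le> size l"
    "v = p_part l'" "is_partition l'" "j \<le> size l'" by auto
  then have "u * v = p_part (l + l')" by (simp add: p_part_add)
  then show "u * v \<in> symfun.span (p_part ` {l. is_partition l \<and> i + j \<le> size l})"
    using * by (intro symfun.span_base image_eqI) (auto simp: is_partition_def)
qed

lemma p_part_in_p_filtration: "is_partition l \<Longrightarrow> j \<le> size l \<Longrightarrow> p_part l \<in> p_filtration j"
  unfolding p_filtration_def by (intro symfun.span_base) auto

lemma p_sym_in_p_filtration: "k > 0 \<Longrightarrow> j \<le> 1 \<Longrightarrow> p_sym k \<in> p_filtration j"
  using p_part_in_p_filtration[of "{#k#}" j] by (simp add: is_partition_def)

lemma one_in_p_filtration: "1 \<in> p_filtration 0"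
  using p_part_in_p_filtration[of "{#}" 0] by (simp add: is_partition_def)

lemma p_filtration_0: "0 \<in> p_filtration j"
  unfolding p_filtration_def by (rule symfun.span_zero)

lemma p_filtration_add: "f \<in> p_filtration j \<Longrightarrow> g \<in> p_filtration j \<Longrightarrow> f + g \<in> p_filtration j"
  unfolding p_filtration_def by (rule symfun.span_add)

lemma p_filtration_scale: "f \<in> p_filtration j \<Longrightarrow> mfps_const c * f \<in> p_filtration j"
  unfolding p_filtration_def by (rule symfun.span_scale)

lemma p_filtration_sum: "(\<And>i. i \<in> I \<Longrightarrow> f i \<in> p_filtration j) \<Longrightarrow> sum f I \<in> p_filtration j"
  unfolding p_filtration_def by (rule symfun.span_sum)

lemma p_filtration_0_prod: "(\<And>i. i \<in> I \<Longrightarrow> f i \<in> p_filtration 0) \<Longrightarrow> prod f I \<in> p_filtration 0"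
  using p_filtration_mult[of _ 0 _ 0] by (induction I rule: infinite_finite_induct) (auto simp: one_in_p_filtration)

lemma p_filtration_0_prod_mset:
  "(\<And>k. k \<in># l \<Longrightarrow> f k \<in> p_filtration 0) \<Longrightarrow> (\<Prod>k\<in>#l. f k) \<in> p_filtration 0"
  using p_filtration_mult[of _ 0 _ 0] by (induction l) (auto simp: one_in_p_filtration)

section \<open>Newton's identity and independence of \<open>h_part\<close>\<close>

lemma mcoeff_h_sym: "mcoeff (h_sym n) M = (if size M = n then 1 else 0)"
  by (simp add: h_sym_def)

lemma h_sym_0 [simp]: "h_sym 0 = 1"
  by (rule mfps_eqI) (simp add: mcoeff_h_sym mcoeff_1)

text \<open>At a monomial \<open>M\<close> of degree n the right-hand side counts the pairs of a
  variable i and a number k with \<open>1 \<le> k \<le> count M i\<close>; each variable accounts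
  for its multiplicity, and these add up to n.\<close>

lemma newton_identity: "mfps_const (of_nat n) * h_sym n = (\<Sum>k=1..n. p_sym k * h_sym (n - k))"
proof (rule mfps_eqI)
  fix M :: "nat multiset"
  have "mcoeff (\<Sum>k=1..n. p_sym k * h_sym (n - k)) M =
      (\<Sum>k=1..n. \<Sum>i | k \<le> count M i. if size M = n then 1 else 0)"
    unfolding mcoeff_sum
  proof (rule sum.cong[OF refl])
    fix k assume k: "k \<in> {1..n}"
    then have "mcoeff (p_sym k * h_sym (n - k)) M =
        (\<Sum>i | k \<le> count M i. mcoeff (h_sym (n - k)) (M - replicate_mset k i))"
      by (intro mcoeff_p_sym_mult) simp
    also have "\<dots> = (\<Sum>i | k \<le> count M i. if size M = n then 1 else 0)"
    proof (rule sum.cong[OF refl])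
      fix i assume "i \<in> {i. k \<le> count M i}"
      then have "M = replicate_mset k i + (M - replicate_mset k i)"
        by (simp add: replicate_mset_subset_iff)
      then have "size M = k + size (M - replicate_mset k i)"
        by (metis size_replicate_mset size_union)
      then show "mcoeff (h_sym (n - k)) (M - replicate_mset k i) = (if size M = n then 1 else 0)"
        using k by (auto simp: mcoeff_h_sym)
    qed
    finally show "mcoeff (p_sym k * h_sym (n - k)) M = (\<Sum>i | k \<le> count M i. if size M = n then 1 else 0)" .
  qed
  also have "\<dots> = (if size M = n then of_nat (\<Sum>k=1..n. card {i. k \<le> count M i}) else 0)"
    by simp
  also have "\<dots> = (if size M = n then of_nat n else 0)"
  proof (cases "size M = n")
    case True
    have le: "count M i \<le> n" for i using True count_le_size by metis
    have "(\<Sum>k=1..n. card {i. k \<le> count M i}) = (\<Sum>k=1..n. \<Sum>i\<in>set_mset M. if k \<le> count M i then 1 else 0)"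
    proof (rule sum.cong[OF refl])
      fix k assume "k \<in> {1..n}"
      then have "{i. k \<le> count M i} = {i \<in> set_mset M. k \<le> count M i}"
        by (auto intro: ccontr simp: not_in_iff)
      then show "card {i. k \<le> count M i} = (\<Sum>i\<in>set_mset M. if k \<le> count M i then 1 else 0)"
        by (simp add: sum.If_cases Int_def)
    qed
    also have "\<dots> = (\<Sum>i\<in>set_mset M. \<Sum>k=1..n. if k \<le> count M i then 1 else 0)" by (rule sum.swap)
    also have "\<dots> = (\<Sum>i\<in>set_mset M. count M i)"
    proof (rule sum.cong[OF refl])
      fix i
      have "{1..n} \<inter> {k. k \<le> count M i} = {1..count M i}" using le[of i] by auto
      then show "(\<Sum>k=1..n. if k \<le> count M i then 1 else 0) = count M i" by (simp add: sum.If_cases)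
    qed
    also have "\<dots> = n" using True by (simp add: size_multiset_overloaded_eq)
    finally show ?thesis using True by simp
  qed simp
  finally show "mcoeff (mfps_const (of_nat n) * h_sym n) M = mcoeff (\<Sum>k=1..n. p_sym k * h_sym (n - k)) M"
    by (simp add: mcoeff_h_sym)
qed

text \<open>In Newton's identity the summand \<open>k = n\<close> is \<open>p_sym n\<close>, while
  for \<open>k < n\<close> the summand is a product of two members of
  \<open>p_filtration 1\<close>.\<close>

lemma h_sym_leading_term:
  "n > 0 \<Longrightarrow> h_sym n \<in> p_filtration 1 \<and> h_sym n - mfps_const (1 / of_nat n) * p_sym n \<in> p_filtration 2"
proof (induction n rule: less_induct)
  case (less n)
  have n: "{1..n} = insert n {1..<n}" using less.prems by auto
  have "(\<Sum>k=1..n. p_sym k * h_sym (n - k)) = p_sym n + (\<Sum>k=1..<n. p_sym k * h_sym (n - k))"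
    by (simp add: n del: One_nat_def)
  then have "mfps_const (of_nat n) * h_sym n = p_sym n + (\<Sum>k=1..<n. p_sym k * h_sym (n - k))"
    using newton_identity[of n] by simp
  moreover have "h_sym n = mfps_const (1 / of_nat n) * (mfps_const (of_nat n) * h_sym n)"
    using less.prems by (simp add: symfun.scale_scale)
  ultimately have "h_sym n =
      mfps_const (1 / of_nat n) * (p_sym n + (\<Sum>k=1..<n. p_sym k * h_sym (n - k)))"
    by simp
  moreover have "(\<Sum>k=1..<n. p_sym k * h_sym (n - k)) \<in> p_filtration 2"
  proof (rule p_filtration_sum)
    fix k assume k: "k \<in> {1..<n}"
    then have "p_sym k * h_sym (n - k) \<in> p_filtration (1 + 1)"
      using less.IH[of "n - k"] by (intro p_filtration_mult p_sym_in_p_filtration) auto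
    then show "p_sym k * h_sym (n - k) \<in> p_filtration 2" by (simp add: numeral_2_eq_2)
  qed
  ultimately have eq: "h_sym n - mfps_const (1 / of_nat n) * p_sym n \<in> p_filtration 2"
    by (simp add: distrib_left p_filtration_scale)
  moreover have "mfps_const (1 / of_nat n) * p_sym n \<in> p_filtration 1"
    using less.prems by (intro p_filtration_scale p_sym_in_p_filtration) auto
  ultimately have "(h_sym n - mfps_const (1 / of_nat n) * p_sym n) + mfps_const (1 / of_nat n) * p_sym n
      \<in> p_filtration 1"
    using p_filtration_mono[of 1 2] by (intro p_filtration_add) auto
  then show ?case using eq by simp
qed

lemma h_sym_in_p_filtration: "h_sym n \<in> p_filtration 0"
  using h_sym_leading_term[of n] p_filtration_mono[of 0 1] one_in_p_filtration by (cases "n = 0") auto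

text \<open>The constant built by the induction is the product of 1/k over the parts k; what is used
  of it is that it does not vanish.\<close>

lemma h_part_leading_term:
  "is_partition l \<Longrightarrow> h_part l \<in> p_filtration (size l) \<and>
     (\<exists>c. c \<noteq> 0 \<and> h_part l - mfps_const c * p_part l \<in> p_filtration (Suc (size l)))"
proof (induction l)
  case empty
  then show ?case using one_in_p_filtration
    by (auto simp: h_part_def p_filtration_0 intro!: exI[of _ 1])
next
  case (add k l)
  then have k: "k > 0" and l: "is_partition l" by (auto simp: is_partition_def)
  from add.IH[OF l] obtain c where c: "c \<noteq> 0"
    and hl: "h_part l \<in> p_filtration (size l)" "h_part l - mfps_const c * p_part l \<in> p_filtration (Suc (size l))"
    by auto
  let ?d = "1 / of_nat k :: complex"
  have hk: "h_sym k \<in> p_filtration 1" "h_sym k - mfps_const ?d * p_sym k \<in> p_filtration 2"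
    using h_sym_leading_term[OF k] by auto
  \<comment> \<open>Factors are replaced by their leading terms one at a time, so each of the two
    errors has one factor in a deeper step of the filtration.\<close>
  have "h_part (add_mset k l) - mfps_const (?d * c) * p_part (add_mset k l) =
      (h_sym k - mfps_const ?d * p_sym k) * h_part l +
      mfps_const ?d * (p_sym k * (h_part l - mfps_const c * p_part l))"
    unfolding mfps_const_mult by (simp add: h_part_def algebra_simps)
  also have "\<dots> \<in> p_filtration (Suc (size (add_mset k l)))"
  proof (intro p_filtration_add p_filtration_scale)
    show "(h_sym k - mfps_const ?d * p_sym k) * h_part l \<in> p_filtration (Suc (size (add_mset k l)))"
      using p_filtration_mult[OF hk(2) hl(1)] by simp
    show "p_sym k * (h_part l - mfps_const c * p_part l) \<in> p_filtration (Suc (size (add_mset k l)))"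
      using p_filtration_mult[OF p_sym_in_p_filtration[OF k, of 1] hl(2)] by simp
  qed
  finally have "h_part (add_mset k l) - mfps_const (?d * c) * p_part (add_mset k l) \<in>
    p_filtration (Suc (size (add_mset k l)))" .
  moreover have "h_part (add_mset k l) \<in> p_filtration (size (add_mset k l))"
    using p_filtration_mult[OF hk(1) hl(1)] by (simp add: h_part_def)
  ultimately show ?case using c k by (intro conjI exI[of _ "?d * c"]) auto
qed

text \<open>Here the \<open>THE\<close> of \<open>sym_coords\<close> becomes usable: the span gives
  existence, independence gives uniqueness, and the generators chosen for the span bound the number
  of parts from below.\<close>

lemma is_coords_sym_coords_p:
  assumes "f \<in> p_filtration j"
  shows "is_coords p_part f (sym_coords p_part f)"
    and "sym_coords p_part f l \<noteq> 0 \<Longrightarrow> j \<le> size l"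
proof -
  obtain c where c: "is_coords p_part f c" "\<forall>l. c l \<noteq> 0 \<longrightarrow> l \<in> {l. is_partition l \<and> size l \<ge> j}"
    using span_imp_is_coords[OF assms[unfolded p_filtration_def]] by auto
  have "sym_coords p_part f = c" using sym_coords_eqI[OF partition_indep_p_part c(1)] .
  then show "is_coords p_part f (sym_coords p_part f)" "sym_coords p_part f l \<noteq> 0 \<Longrightarrow> j \<le> size l"
    using c by auto
qed

lemma sym_coords_p_part_sum:
  assumes "finite A" "\<And>i. i \<in> A \<Longrightarrow> f i \<in> p_filtration 0"
  shows "sym_coords p_part (\<Sum>i\<in>A. mfps_const (c i) * f i) = (\<lambda>l. \<Sum>i\<in>A. c i * sym_coords p_part (f i) l)"
proof (rule sym_coords_eqI[OF partition_indep_p_part])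
  show "is_coords p_part (\<Sum>i\<in>A. mfps_const (c i) * f i) (\<lambda>l. \<Sum>i\<in>A. c i * sym_coords p_part (f i) l)"
    using assms
  proof (induction A rule: finite_induct)
    case empty
    then show ?case by (simp add: is_coords_0)
  next
    case (insert i A)
    then show ?case
      using is_coords_add[OF is_coords_scale[OF is_coords_sym_coords_p(1)[of "f i" 0]]] by simp
  qed
qed

text \<open>The functionals are the \<open>p_part\<close> coordinates. Apart from a nonzero multiple
  of \<open>p_part l'\<close>, the expansion of \<open>h_part l'\<close> involves only partitions
  with more parts, which is why the rank is the negative number of parts.\<close>

lemma partition_indep_h_part: "partition_indep h_part"
proof (rule partition_indep_triangular[where \<phi> = "\<lambda>l f. sym_coords p_part f l" and rank = "\<lambda>l. - int (size l)"])
  have h: "h_part l \<in> p_filtration 0" if "is_partition l" for l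
    using h_part_leading_term[OF that] p_filtration_mono by blast
  fix l :: "nat multiset" and A and c :: "nat multiset \<Rightarrow> complex"
  assume "finite A" "\<forall>l'\<in>A. is_partition l'"
  then show "sym_coords p_part (\<Sum>l'\<in>A. mfps_const (c l') * h_part l') l =
      (\<Sum>l'\<in>A. c l' * sym_coords p_part (h_part l') l)"
    using h by (subst sym_coords_p_part_sum) auto
next
  have *: "\<exists>c g. c \<noteq> 0 \<and> g \<in> p_filtration (Suc (size l)) \<and>
      sym_coords p_part (h_part l) = (\<lambda>l'. c * (if l' = l then 1 else 0) + sym_coords p_part g l')"
    if l: "is_partition l" for l
  proof -
    obtain c where c: "c \<noteq> 0" "h_part l - mfps_const c * p_part l \<in> p_filtration (Suc (size l))"
      using h_part_leading_term[OF l] by auto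
    define g where "g = h_part l - mfps_const c * p_part l"
    have "is_coords p_part (mfps_const c * p_part l + g)
        (\<lambda>l'. c * (if l' = l then 1 else 0) + sym_coords p_part g l')"
      using c(2) unfolding g_def[symmetric]
      by (intro is_coords_add is_coords_scale is_coords_single l is_coords_sym_coords_p(1))
    then show ?thesis
      using c sym_coords_eqI[OF partition_indep_p_part] by (auto simp: g_def)
  qed
  show "sym_coords p_part (h_part l) l \<noteq> 0" if "is_partition l" for l
    using *[OF that] is_coords_sym_coords_p(2)[of _ "Suc (size l)" l] by fastforce
  show "l = l' \<or> - int (size l) < - int (size l')"
    if "is_partition l" "is_partition l'" "sym_coords p_part (h_part l') l \<noteq> 0" for l l'
    using *[OF that(2)] that(3) is_coords_sym_coords_p(2)[of _ "Suc (size l')" l] by fastforce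
qed

section \<open>Specialisation to one variable, plethysm and the Hall inner product\<close>

text \<open>The substitution of X for the variable 0 and of 0 for every other variable, expressed by
  keeping the coefficients of the powers of variable 0.\<close>

definition one_var :: "symfun \<Rightarrow> complex fps" where
  "one_var f = Abs_fps (\<lambda>n. mcoeff f (replicate_mset n 0))"

lemma one_var_nth: "fps_nth (one_var f) n = mcoeff f (replicate_mset n 0)"
  by (simp add: one_var_def)

lemma one_var_0 [simp]: "one_var 0 = 0"
  by (rule fps_ext) (simp add: one_var_nth)

lemma one_var_1 [simp]: "one_var 1 = 1"
  by (rule fps_ext) (simp add: one_var_nth mcoeff_1)

lemma one_var_add [simp]: "one_var (f + g) = one_var f + one_var g"
  by (rule fps_ext) (simp add: one_var_nth)

lemma one_var_scale: "one_var (mfps_const c * f) = fps_const c * one_var f"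
  by (rule fps_ext) (simp add: one_var_nth)

lemma splits_replicate_mset:
  "{(A, B). A + B = replicate_mset n x} =
     (\<lambda>i. (replicate_mset i x, replicate_mset (n - i) x)) ` {0..n}"
proof (intro equalityI subsetI)
  fix p assume "p \<in> {(A, B). A + B = replicate_mset n x}"
  then obtain A B where p: "p = (A, B)" "A + B = replicate_mset n x" by auto
  have "set_mset (A + B) \<subseteq> {x}" using p(2) by simp
  then have "A = replicate_mset (size A) x" "B = replicate_mset (size B) x"
    by (auto intro!: set_mset_subset_singletonD)
  moreover have "size A + size B = n" using p(2) by (metis size_replicate_mset size_union)
  ultimately show "p \<in> (\<lambda>i. (replicate_mset i x, replicate_mset (n - i) x)) ` {0..n}"
    unfolding p(1) by (intro image_eqI[of _ _ "size A"]) auto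
next
  fix p assume "p \<in> (\<lambda>i. (replicate_mset i x, replicate_mset (n - i) x)) ` {0..n}"
  then obtain i where "i \<le> n" "p = (replicate_mset i x, replicate_mset (n - i) x)" by auto
  moreover have "replicate_mset i x + replicate_mset (n - i) x = replicate_mset n x" if "i \<le> n"
    using that by (intro multiset_eqI) simp
  ultimately show "p \<in> {(A, B). A + B = replicate_mset n x}" by simp
qed

lemma one_var_mult [simp]: "one_var (f * g) = one_var f * one_var g"
proof (rule fps_ext)
  fix n
  have "inj_on (\<lambda>i. (replicate_mset i (0 :: nat), replicate_mset (n - i) (0 :: nat))) {0..n}"
    by (auto simp: inj_on_def) (metis size_replicate_mset)
  then show "fps_nth (one_var (f * g)) n = fps_nth (one_var f * one_var g) n"
    by (simp add: one_var_nth mcoeff_mult splits_replicate_mset fps_mult_nth sum.reindex)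
qed

lemma one_var_sum [simp]: "one_var (sum f I) = (\<Sum>i\<in>I. one_var (f i))"
  by (induction I rule: infinite_finite_induct) simp_all

lemma one_var_prod [simp]: "one_var (prod f I) = (\<Prod>i\<in>I. one_var (f i))"
  by (induction I rule: infinite_finite_induct) simp_all

lemma one_var_prod_mset [simp]: "one_var (\<Prod>k\<in>#l. f k) = (\<Prod>k\<in>#l. one_var (f k))"
  by (induction l) simp_all

lemma fps_X_power_prod_mset: "(\<Prod>k\<in>#l. fps_X ^ f k) = fps_X ^ (\<Sum>k\<in>#l. f k)"
  by (induction l) (simp_all add: power_add)

lemma one_var_p_sym: "one_var (p_sym k) = fps_X ^ k"
  by (rule fps_ext) (auto simp: one_var_nth p_sym_def fps_X_power_iff replicate_mset_eq_iff)

lemma one_var_h_sym: "one_var (h_sym n) = fps_X ^ n"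
  by (rule fps_ext) (auto simp: one_var_nth mcoeff_h_sym fps_X_power_iff)

lemma one_var_p_part: "one_var (p_part l) = fps_X ^ sum_mset l"
  using fps_X_power_prod_mset[of "\<lambda>k. k" l] by (simp add: p_part_def one_var_p_sym)

lemma one_var_h_part: "one_var (h_part l) = fps_X ^ sum_mset l"
  using fps_X_power_prod_mset[of "\<lambda>k. k" l] by (simp add: h_part_def one_var_h_sym)

section \<open>Adams operations and plethysm\<close>

lemma mcoeff_adams_repeat: "k > 0 \<Longrightarrow> mcoeff (adams k g) (repeat_mset k N) = mcoeff g N"
  by (simp add: adams_def repeat_mset_cancel1)

lemma mcoeff_adams_not_repeat: "(\<And>N. M \<noteq> repeat_mset k N) \<Longrightarrow> mcoeff (adams k g) M = 0"
  unfolding adams_def mcoeff_Abs_mfps by (subst sum.neutral) auto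

text \<open>For \<open>k > 0\<close> taking k-th powers of monomials is injective, so the sum
  defining \<open>adams\<close> has at most one term. A candidate is checked separately on k-th
  powers and on all other monomials.\<close>

lemma adams_eqI:
  assumes k: "k > 0" and "\<And>N. mcoeff f (repeat_mset k N) = mcoeff g N"
    and "\<And>M. (\<And>N. M \<noteq> repeat_mset k N) \<Longrightarrow> mcoeff f M = 0"
  shows "adams k g = f"
proof (rule mfps_eqI)
  fix M
  show "mcoeff (adams k g) M = mcoeff f M"
  proof (cases "\<exists>N. M = repeat_mset k N")
    case True
    then show ?thesis using assms(2) mcoeff_adams_repeat[OF k] by auto
  next
    case False
    then show ?thesis using assms(3) mcoeff_adams_not_repeat by auto
  qed
qed

lemma adams_0 [simp]: "k > 0 \<Longrightarrow> adams k 0 = 0"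
  by (rule adams_eqI) simp_all

lemma adams_1 [simp]: "k > 0 \<Longrightarrow> adams k 1 = 1"
proof (rule adams_eqI)
  show "mcoeff 1 M = (0 :: complex)" if "\<And>N. M \<noteq> repeat_mset k N" for M :: "nat multiset"
    using that[of "{#}"] by (simp add: mcoeff_1)
qed (simp_all add: mcoeff_1 repeat_mset_eq_empty_iff)

lemma adams_add: "k > 0 \<Longrightarrow> adams k (f + g) = adams k f + adams k g"
  by (rule adams_eqI) (simp_all add: mcoeff_adams_repeat mcoeff_adams_not_repeat)

lemma adams_scale: "k > 0 \<Longrightarrow> adams k (mfps_const c * f) = mfps_const c * adams k f"
  by (rule adams_eqI) (simp_all add: mcoeff_adams_repeat mcoeff_adams_not_repeat)

text \<open>Only splittings into two k-th powers contribute, and for a k-th power these correspond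
  to the splittings of its root.\<close>

lemma adams_mult:
  assumes k: "k > 0"
  shows "adams k (f * g) = adams k f * adams k g"
proof (rule adams_eqI[OF k])
  fix N :: "nat multiset"
  let ?D = "{(A, B). A + B = N}" and ?E = "{(A, B). A + B = repeat_mset k N}"
  let ?j = "\<lambda>(A, B). (repeat_mset k A, repeat_mset k B)"
  have "mcoeff (adams k f * adams k g) (repeat_mset k N) =
      (\<Sum>(A, B)\<in>?j ` ?D. mcoeff (adams k f) A * mcoeff (adams k g) B)"
    unfolding mcoeff_mult
  proof (rule sum.mono_neutral_right)
    show "?j ` ?D \<subseteq> ?E" by auto
    show "\<forall>p\<in>?E - ?j ` ?D. (case p of (A, B) \<Rightarrow> mcoeff (adams k f) A * mcoeff (adams k g) B) = 0"
    proof (clarify, rule ccontr)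
      fix A B assume E: "A + B = repeat_mset k N" and not: "(A, B) \<notin> ?j ` ?D"
        and ne: "mcoeff (adams k f) A * mcoeff (adams k g) B \<noteq> 0"
      then obtain A' B' where AB: "A = repeat_mset k A'" "B = repeat_mset k B'"
        using mcoeff_adams_not_repeat by (metis mult_eq_0_iff)
      then have "repeat_mset k (A' + B') = repeat_mset k N" using E by simp
      then have "(A', B') \<in> ?D" using k by (simp add: repeat_mset_cancel1 del: repeat_mset_distrib2)
      then show False using not AB by force
    qed
  qed (simp add: finite_mset_splits)
  also have "\<dots> = (\<Sum>(A, B)\<in>?D. mcoeff f A * mcoeff g B)"
    using k by (subst sum.reindex)
      (auto simp: inj_on_def repeat_mset_cancel1 mcoeff_adams_repeat intro!: sum.cong)
  finally show "mcoeff (adams k f * adams k g) (repeat_mset k N) = mcoeff (f * g) N"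
    by (simp add: mcoeff_mult)
next
  fix M :: "nat multiset" assume M: "\<And>N. M \<noteq> repeat_mset k N"
  show "mcoeff (adams k f * adams k g) M = 0"
    unfolding mcoeff_mult
  proof (rule sum.neutral, clarify, rule ccontr)
    fix A B assume E: "M = A + B" and ne: "mcoeff (adams k f) A * mcoeff (adams k g) B \<noteq> 0"
    then obtain A' B' where AB: "A = repeat_mset k A'" "B = repeat_mset k B'"
      using mcoeff_adams_not_repeat by (metis mult_eq_0_iff)
    then show False using M[of "A' + B'"] E by simp
  qed
qed

lemma adams_p_sym:
  assumes k: "k > 0"
  shows "adams k (p_sym j) = p_sym (k * j)"
proof (rule adams_eqI[OF k])
  have rep: "repeat_mset k (replicate_mset j i) = replicate_mset (k * j) i" for i :: nat
    by (rule multiset_eqI) simp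
  show "mcoeff (p_sym (k * j)) (repeat_mset k N) = mcoeff (p_sym j) N" for N
    using k by (simp add: p_sym_def rep[symmetric] repeat_mset_cancel1 del: repeat_mset_replicate_mset)
  show "mcoeff (p_sym (k * j)) M = 0" if "\<And>N. M \<noteq> repeat_mset k N" for M
    using that by (auto simp: p_sym_def rep[symmetric])
qed

lemma adams_p_part: "k > 0 \<Longrightarrow> adams k (p_part l) = p_part (image_mset ((*) k) l)"
  by (induction l) (simp_all add: adams_mult adams_p_sym)

text \<open>On generators the operation multiplies all parts by \<open>k\<close>, which again gives
  a partition; linearity does the rest.\<close>

lemma adams_in_p_filtration:
  assumes k: "k > 0" and "f \<in> p_filtration 0"
  shows "adams k f \<in> p_filtration 0"
  using assms(2) unfolding p_filtration_def
proof (rule symfun.span_induct)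
  let ?S = "symfun.span (p_part ` {l. is_partition l \<and> 0 \<le> size l})"
  show "symfun.subspace {f. adams k f \<in> ?S}"
    using k by (intro symfun.subspaceI)
      (auto simp: adams_add adams_scale intro: symfun.span_zero symfun.span_add symfun.span_scale)
  show "adams k f \<in> ?S" if "f \<in> p_part ` {l. is_partition l \<and> 0 \<le> size l}" for f
  proof -
    from that obtain l where l: "f = p_part l" "is_partition l" by auto
    then have "is_partition (image_mset ((*) k) l)" using k by (auto simp: is_partition_def)
    then show ?thesis using l k by (auto simp: adams_p_part intro!: symfun.span_base)
  qed
qed

lemma one_var_adams_nth:
  assumes k: "k > 0"
  shows "fps_nth (one_var (adams k g)) n = (if k dvd n then fps_nth (one_var g) (n div k) else 0)"
proof (cases "k dvd n")
  case True
  then have "replicate_mset n (0 :: nat) = repeat_mset k (replicate_mset (n div k) 0)"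
    by (intro multiset_eqI) simp
  then show ?thesis using True k by (simp add: one_var_nth mcoeff_adams_repeat del: repeat_mset_replicate_mset)
next
  case False
  have "replicate_mset n (0 :: nat) \<noteq> repeat_mset k N" for N
  proof
    assume "replicate_mset n (0 :: nat) = repeat_mset k N"
    then have "n = k * size N" by (metis size_repeat_mset size_replicate_mset)
    then show False using False by simp
  qed
  then show ?thesis using False by (simp add: one_var_nth mcoeff_adams_not_repeat)
qed

lemma one_var_adams_0: "k > 0 \<Longrightarrow> one_var g = 0 \<Longrightarrow> one_var (adams k g) = 0"
  by (rule fps_ext) (simp add: one_var_adams_nth)

lemma one_var_adams_X: "k > 0 \<Longrightarrow> one_var g = fps_X ^ d \<Longrightarrow> one_var (adams k g) = fps_X ^ (k * d)"
  by (rule fps_ext) (auto simp: one_var_adams_nth fps_X_power_iff)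

lemma plethysm_eq:
  assumes "is_coords p_part f c"
  shows "plethysm f g = (\<Sum>l | c l \<noteq> 0. mfps_const (c l) * (\<Prod>k\<in>#l. adams k g))"
  using sym_coords_eqI[OF partition_indep_p_part assms] by (simp add: plethysm_def)

lemma plethysm_1 [simp]: "plethysm 1 g = 1"
  using plethysm_eq[OF is_coords_single[of "{#}" p_part], of g] by (simp add: is_partition_def)

lemma plethysm_in_p_filtration:
  assumes "f \<in> p_filtration 0" "g \<in> p_filtration 0"
  shows "plethysm f g \<in> p_filtration 0"
proof -
  obtain c where c: "is_coords p_part f c" using is_coords_sym_coords_p(1)[OF assms(1)] by blast
  show ?thesis
    unfolding plethysm_eq[OF c]
  proof (intro p_filtration_sum p_filtration_scale p_filtration_0_prod_mset adams_in_p_filtration assms(2))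
    fix l k assume "l \<in> {l. c l \<noteq> 0}" "k \<in># l"
    then have "is_partition l" using c by (simp add: is_coords_def)
    then show "k > 0" using \<open>k \<in># l\<close> by (metis is_partition_def gr0I)
  qed
qed

lemma one_var_is_coords:
  assumes "is_coords p_part f c"
  shows "one_var f = (\<Sum>l | c l \<noteq> 0. fps_const (c l) * fps_X ^ sum_mset l)"
proof -
  have "one_var f = one_var (\<Sum>l | c l \<noteq> 0. mfps_const (c l) * p_part l)"
    using assms by (simp only: is_coords_def)
  then show ?thesis by (simp only: one_var_sum one_var_scale one_var_p_part)
qed

text \<open>Plethysm of \<open>p_part l\<close> with \<open>g\<close> specialises to X to the power
  \<open>d\<close> times the sum of \<open>l\<close>, which is the value of
  \<open>one_var (p_part l)\<close> at X^d; linearity in power sum coordinates extends this to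
  \<open>f\<close>. Composition of series requires a zero constant term, hence
  \<open>d > 0\<close>.\<close>

lemma one_var_plethysm_X:
  assumes f: "f \<in> p_filtration 0" and g: "one_var g = fps_X ^ d" and "d > 0"
  shows "one_var (plethysm f g) = one_var f oo fps_X ^ d"
proof -
  obtain c where c: "is_coords p_part f c" using is_coords_sym_coords_p(1)[OF f] by blast
  have "one_var (plethysm f g) = (\<Sum>l | c l \<noteq> 0. fps_const (c l) * fps_X ^ (sum_mset l * d))"
    unfolding plethysm_eq[OF c] one_var_sum one_var_scale one_var_prod_mset
  proof (rule sum.cong[OF refl])
    fix l assume "l \<in> {l. c l \<noteq> 0}"
    then have l: "is_partition l" using c by (simp add: is_coords_def)
    have "(\<Prod>k\<in>#l. one_var (adams k g)) = (\<Prod>k\<in>#l. fps_X ^ (k * d))"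
    proof (intro arg_cong[of _ _ prod_mset] image_mset_cong one_var_adams_X g)
      show "k > 0" if "k \<in># l" for k using l that by (metis is_partition_def gr0I)
    qed
    moreover have "(\<Sum>k\<in>#l. k * d) = sum_mset l * d"
      by (induction l) (simp_all add: algebra_simps)
    ultimately show "fps_const (c l) * (\<Prod>k\<in>#l. one_var (adams k g)) = fps_const (c l) * fps_X ^ (sum_mset l * d)"
      by (simp add: fps_X_power_prod_mset)
  qed
  moreover have "one_var f oo fps_X ^ d = (\<Sum>l | c l \<noteq> 0. fps_const (c l) * fps_X ^ (sum_mset l * d))"
    unfolding one_var_is_coords[OF c] fps_compose_sum_distrib
  proof (rule sum.cong[OF refl])
    fix l
    have X: "fps_nth (fps_X ^ d :: complex fps) 0 = 0" using \<open>d > 0\<close> by simp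
    show "(fps_const (c l) * fps_X ^ sum_mset l) oo fps_X ^ d = fps_const (c l) * fps_X ^ (sum_mset l * d)"
      using X by (simp add: fps_compose_mult_distrib fps_compose_power mult.commute[of _ d] power_mult
          flip: fps_compose_power)
  qed
  ultimately show ?thesis by simp
qed

text \<open>The empty partition is the only one of sum 0, so the constant term of \<open>f\<close>
  is its coordinate at \<open>{#}\<close> and this vanishes. Every other product of Adams operations
  contains a factor that specialises to 0.\<close>

lemma one_var_plethysm_0:
  assumes f: "f \<in> p_filtration 0" and g: "one_var g = 0" and "mcoeff f {#} = 0"
  shows "one_var (plethysm f g) = 0"
proof -
  obtain c where c: "is_coords p_part f c" using is_coords_sym_coords_p(1)[OF f] by blast
  have sum0: "sum_mset l = 0 \<longleftrightarrow> l = {#}" if "c l \<noteq> 0" for l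
  proof -
    have "is_partition l" using c that by (simp add: is_coords_def)
    then show ?thesis by (cases l) (auto simp: is_partition_def)
  qed
  have "0 = fps_nth (one_var f) 0" using assms(3) by (simp add: one_var_nth)
  also have "\<dots> = (\<Sum>l | c l \<noteq> 0. if sum_mset l = 0 then c l else 0)"
    unfolding one_var_is_coords[OF c] fps_sum_nth by (intro sum.cong) (auto simp: fps_X_power_iff)
  also have "\<dots> = (\<Sum>l | c l \<noteq> 0. if l = {#} then c l else 0)"
    using sum0 by (intro sum.cong) auto
  also have "\<dots> = c {#}" using c by (auto simp: is_coords_def)
  finally have empty: "c {#} = 0" by simp
  show ?thesis
    unfolding plethysm_eq[OF c] one_var_sum one_var_scale one_var_prod_mset
  proof (rule sum.neutral, rule ballI)
    fix l assume l: "l \<in> {l. c l \<noteq> 0}"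
    then obtain k l' where kl: "l = add_mset k l'" using empty by (cases l) auto
    have "is_partition l" using c l by (simp add: is_coords_def)
    then have "one_var (adams k g) = 0" using g kl by (intro one_var_adams_0) (auto simp: is_partition_def)
    then show "fps_const (c l) * (\<Prod>k\<in>#l. one_var (adams k g)) = 0" by (simp add: kl)
  qed
qed

section \<open>Monomial coordinates from invariance and bounded degree; the Hall pairing\<close>

definition bounded_symmetric :: "symfun \<Rightarrow> bool" where
  "bounded_symmetric f \<longleftrightarrow> (\<forall>\<sigma> M. bij \<sigma> \<longrightarrow> mcoeff f (image_mset \<sigma> M) = mcoeff f M) \<and>
     (\<exists>d. \<forall>M. size M > d \<longrightarrow> mcoeff f M = 0)"

lemma bounded_symmetric_mult:
  assumes "bounded_symmetric f" "bounded_symmetric g"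
  shows "bounded_symmetric (f * g)"
  unfolding bounded_symmetric_def
proof (intro conjI allI impI)
  fix \<sigma> :: "nat \<Rightarrow> nat" and M assume \<sigma>: "bij \<sigma>"
  have inv: "image_mset (inv \<sigma>) (image_mset \<sigma> N) = N" "image_mset \<sigma> (image_mset (inv \<sigma>) N) = N" for N
    using \<sigma> by (simp_all add: multiset.map_comp bij_is_inj bij_is_surj surj_iff[THEN iffD1] comp_def
        surj_f_inv_f)
  show "mcoeff (f * g) (image_mset \<sigma> M) = mcoeff (f * g) M"
    unfolding mcoeff_mult
    by (rule sum.reindex_bij_witness[where
          i = "\<lambda>(A, B). (image_mset \<sigma> A, image_mset \<sigma> B)" and
          j = "\<lambda>(A, B). (image_mset (inv \<sigma>) A, image_mset (inv \<sigma>) B)"])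
      (use assms \<sigma> inv in \<open>auto simp: bounded_symmetric_def bij_imp_bij_inv simp flip: image_mset_union\<close>)
next
  from assms obtain d e where d: "\<forall>M. size M > d \<longrightarrow> mcoeff f M = 0"
    and e: "\<forall>M. size M > e \<longrightarrow> mcoeff g M = 0"
    by (auto simp: bounded_symmetric_def)
  have "mcoeff (f * g) M = 0" if "size M > d + e" for M
    unfolding mcoeff_mult
  proof (rule sum.neutral, clarify)
    fix A B assume "M = A + B"
    then have "size A > d \<or> size B > e" using that by auto
    then show "mcoeff f A * mcoeff g B = 0" using d e by auto
  qed
  then show "\<exists>d. \<forall>M. size M > d \<longrightarrow> mcoeff (f * g) M = 0" by blast
qed

lemma bounded_symmetric_1: "bounded_symmetric 1"
  by (auto simp: bounded_symmetric_def mcoeff_1 intro!: exI[of _ 0])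

lemma bounded_symmetric_p_sym: "bounded_symmetric (p_sym k)"
  unfolding bounded_symmetric_def
proof (intro conjI allI impI)
  fix \<sigma> :: "nat \<Rightarrow> nat" and M assume \<sigma>: "bij \<sigma>"
  have "(\<exists>i. image_mset \<sigma> M = replicate_mset k i) \<longleftrightarrow> (\<exists>i. M = replicate_mset k i)"
  proof
    assume "\<exists>i. image_mset \<sigma> M = replicate_mset k i"
    then obtain i where i: "image_mset \<sigma> M = replicate_mset k i" ..
    have "M = image_mset (inv \<sigma>) (image_mset \<sigma> M)"
      using \<sigma> by (simp add: multiset.map_comp bij_is_inj)
    then have "M = replicate_mset k (inv \<sigma> i)" unfolding i by simp
    then show "\<exists>i. M = replicate_mset k i" ..
  qed auto
  then show "mcoeff (p_sym k) (image_mset \<sigma> M) = mcoeff (p_sym k) M"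
    by (simp add: p_sym_def)
next
  show "\<exists>d. \<forall>M. d < size M \<longrightarrow> mcoeff (p_sym k) M = 0"
    by (intro exI[of _ k]) (auto simp: p_sym_def)
qed

lemma bounded_symmetric_p_part: "bounded_symmetric (p_part l)"
  by (induction l) (simp_all add: bounded_symmetric_1 bounded_symmetric_mult bounded_symmetric_p_sym)

lemma p_filtration_bounded_symmetric:
  assumes "f \<in> p_filtration 0"
  shows "bounded_symmetric f"
  using assms unfolding p_filtration_def
proof (rule symfun.span_induct)
  show "symfun.subspace (Collect bounded_symmetric)"
  proof (rule symfun.subspaceI; clarify)
    show "bounded_symmetric 0" by (simp add: bounded_symmetric_def)
    show "bounded_symmetric (mfps_const c * f)" if "bounded_symmetric f" for c f
      using that by (auto simp: bounded_symmetric_def)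
    fix f g assume fg: "bounded_symmetric f" "bounded_symmetric g"
    then obtain d e where "\<forall>M. size M > d \<longrightarrow> mcoeff f M = 0" "\<forall>M. size M > e \<longrightarrow> mcoeff g M = 0"
      by (auto simp: bounded_symmetric_def)
    then have "\<exists>d. \<forall>M. size M > d \<longrightarrow> mcoeff (f + g) M = 0"
      by (intro exI[of _ "max d e"]) auto
    then show "bounded_symmetric (f + g)" using fg by (simp add: bounded_symmetric_def)
  qed
qed (auto simp: bounded_symmetric_p_part)

text \<open>Pads the exponents with zeros, so that monomials with different supports can be compared
  on a common set of variables.\<close>

lemma image_count_mset_set:
  assumes "finite A" "set_mset M \<subseteq> A"
  shows "image_mset (count M) (mset_set A) = exponents M + replicate_mset (card A - card (set_mset M)) 0"
proof -
  have "mset_set A = mset_set (set_mset M \<union> (A - set_mset M))" using assms by (simp add: Un_absorb1)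
  also have "\<dots> = mset_set (set_mset M) + mset_set (A - set_mset M)"
    using assms by (intro mset_set_Union) auto
  finally have "image_mset (count M) (mset_set A) =
      exponents M + image_mset (count M) (mset_set (A - set_mset M))"
    by (simp add: exponents_def)
  also have "image_mset (count M) (mset_set (A - set_mset M)) =
      image_mset (\<lambda>_. 0) (mset_set (A - set_mset M))"
    using assms by (intro image_mset_cong) (auto simp: not_in_iff)
  also have "\<dots> = replicate_mset (card A - card (set_mset M)) 0"
    using assms by (simp add: image_mset_const_eq card_Diff_subset)
  finally show ?thesis .
qed

text \<open>On the union of the supports both monomials have the same multiset of multiplicities,
  zeros included; a permutation of this finite set matching them fixes all other variables.\<close>

lemma exponents_eq_imp_bij:
  fixes M N :: "nat multiset"
  assumes "exponents M = exponents N"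
  obtains \<sigma> where "bij \<sigma>" "image_mset \<sigma> M = N"
proof -
  let ?A = "set_mset M \<union> set_mset N"
  have "card (set_mset M) = card (set_mset N)" using assms by (metis size_exponents)
  then have "image_mset (count M) (mset_set ?A) = image_mset (count N) (mset_set ?A)"
    using image_count_mset_set[of ?A M] image_count_mset_set[of ?A N] assms by simp
  from image_mset_eq_implies_permutes[OF _ this]
  obtain p where p: "p permutes ?A" "\<forall>x\<in>?A. count M x = count N (p x)" by auto
  have bij: "bij p" using p(1) by (rule permutes_bij)
  have "image_mset p M = N"
  proof (rule multiset_eqI)
    fix y
    obtain x where y: "y = p x" using bij by (metis bij_pointE)
    have "p -` {p x} \<inter> set_mset M = (if x \<in># M then {x} else {})"
      using bij_is_inj[OF bij] by (auto dest: injD)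
    then have "count (image_mset p M) (p x) = count M x"
      by (simp add: count_image_mset not_in_iff)
    also have "\<dots> = count N (p x)"
    proof (cases "x \<in> ?A")
      case False
      then have "p x = x" using p(1) by (simp add: permutes_not_in)
      then show ?thesis using False by (simp add: not_in_iff)
    qed (use p(2) in blast)
    finally show "count (image_mset p M) y = count N y" by (simp add: y)
  qed
  then show thesis using that bij by blast
qed

lemma sum_mset_exponents: "sum_mset (exponents M) = size M"
  by (simp add: exponents_def size_multiset_overloaded_eq sum_unfold_sum_mset)

lemma partition_size_le: "is_partition l \<Longrightarrow> size l \<le> sum_mset l"
  by (induction l) (auto simp: is_partition_def Suc_le_eq intro: less_le_trans)

lemma finite_partitions_le: "finite {l. is_partition l \<and> sum_mset l \<le> d}"
proof (rule finite_subset)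
  show "finite (mset ` {xs. set xs \<subseteq> {..d} \<and> length xs \<le> d})"
    by (intro finite_imageI finite_lists_length_le) simp
  show "{l. is_partition l \<and> sum_mset l \<le> d} \<subseteq> mset ` {xs. set xs \<subseteq> {..d} \<and> length xs \<le> d}"
  proof clarify
    fix l :: "nat multiset" assume l: "is_partition l" "sum_mset l \<le> d"
    obtain xs where xs: "l = mset xs" by (metis ex_mset)
    have "x \<le> d" if "x \<in> set xs" for x
      using member_le_sum_list[OF that] l(2) xs by (simp add: sum_mset_sum_list)
    moreover have "length xs \<le> d" using partition_size_le[OF l(1)] l(2) xs by simp
    ultimately show "l \<in> mset ` {xs. set xs \<subseteq> {..d} \<and> length xs \<le> d}" using xs by auto
  qed
qed

lemma bounded_symmetric_is_coords:
  assumes f: "bounded_symmetric f"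
  shows "\<exists>c. is_coords m_sym f c"
proof -
  obtain \<theta> :: "nat multiset \<Rightarrow> nat multiset" where \<theta>: "\<And>l. is_partition l \<Longrightarrow> exponents (\<theta> l) = l"
    using exponents_surj by metis
  obtain d where d: "\<And>M. size M > d \<Longrightarrow> mcoeff f M = 0" using f by (auto simp: bounded_symmetric_def)
  let ?A = "{l. is_partition l \<and> sum_mset l \<le> d}"
  \<comment> \<open>By invariance, any monomial with exponents \<open>l\<close> would give the same
    value; the degree bound \<open>d\<close> leaves finitely many partitions.\<close>
  define c where "c = (\<lambda>l. if l \<in> ?A then mcoeff f (\<theta> l) else 0)"
  have "is_coords m_sym f c"
  proof (rule is_coordsI[OF finite_partitions_le])
    show "l \<in> ?A" if "c l \<noteq> 0" for l using that by (auto simp: c_def split: if_splits)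
    then show "is_partition l" if "c l \<noteq> 0" for l using that by blast
    show "f = (\<Sum>l\<in>?A. mfps_const (c l) * m_sym l)"
    proof (rule mfps_eqI)
      fix M
      have "mcoeff (\<Sum>l\<in>?A. mfps_const (c l) * m_sym l) M = (\<Sum>l\<in>?A. if exponents M = l then c l else 0)"
        unfolding mcoeff_sum by (intro sum.cong) (auto simp: m_sym_def)
      also have "\<dots> = (if exponents M \<in> ?A then c (exponents M) else 0)"
        using finite_partitions_le[of d] by simp
      also have "\<dots> = mcoeff f M"
      proof (cases "size M \<le> d")
        case True
        have "exponents (\<theta> (exponents M)) = exponents M" by (intro \<theta> is_partition_exponents)
        then obtain \<sigma> where "bij \<sigma>" "image_mset \<sigma> (\<theta> (exponents M)) = M" by (rule exponents_eq_imp_bij)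
        then have "mcoeff f (\<theta> (exponents M)) = mcoeff f M"
          using f by (metis bounded_symmetric_def)
        then show ?thesis using True by (simp add: c_def is_partition_exponents sum_mset_exponents)
      next
        case False
        then show ?thesis using d by (simp add: c_def sum_mset_exponents)
      qed
      finally show "mcoeff f M = mcoeff (\<Sum>l\<in>?A. mfps_const (c l) * m_sym l) M" ..
    qed
  qed
  then show ?thesis by (intro exI[of _ c])
qed

text \<open>For \<open>n > 0\<close> the series \<open>h_sym n\<close> is itself the member of
  \<open>h_part\<close> at \<open>{#n#}\<close>, so the pairing picks out one monomial coordinate.
  It is visible at the n-th power of variable 0, a monomial with exponents
  \<open>{#n#}\<close>.\<close>

lemma hall_h_sym:
  assumes f: "f \<in> p_filtration 0" and "n > 0"
  shows "hall (h_sym n) f = mcoeff f (replicate_mset n 0)"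
proof -
  have n: "is_partition {#n#}" using \<open>n > 0\<close> by (simp add: is_partition_def)
  have "h_part {#n#} = h_sym n" by (simp add: h_part_def)
  then have h: "sym_coords h_part (h_sym n) = (\<lambda>l. if l = {#n#} then 1 else 0)"
    using sym_coords_eqI[OF partition_indep_h_part is_coords_single[OF n]] by simp
  obtain c where c: "is_coords m_sym f c"
    using bounded_symmetric_is_coords p_filtration_bounded_symmetric f by blast
  have "exponents (replicate_mset n (0 :: nat)) = {#n#}"
    using \<open>n > 0\<close> by (simp add: exponents_def)
  then have "mcoeff f (replicate_mset n 0) = (\<Sum>l | c l \<noteq> 0. if l = {#n#} then c l else 0)"
    using c by (subst (1) c[unfolded is_coords_def, THEN conjunct2, THEN conjunct2])
      (auto simp: m_sym_def intro!: sum.cong)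
  also have "\<dots> = c {#n#}" using c by (auto simp: is_coords_def)
  finally show ?thesis
    using sym_coords_eqI[OF partition_indep_m_sym c] by (simp add: hall_def h)
qed

section \<open>The generating function\<close>

lemma orbits_partition:
  assumes s: "s permutes S" "finite S"
  shows "partition_on S (orbit s ` S)"
proof (rule partition_onI)
  have perm: "permutation s" using s permutation_permutes by blast
  show "\<Union> (orbit s ` S) = S"
    using permutes_orbit_subset[OF s(1)] permutation_self_in_orbit[OF perm] by blast
  show "{} \<notin> orbit s ` S" using orbit_nonempty by (metis imageE)
  fix p q assume "p \<in> orbit s ` S" "q \<in> orbit s ` S" "p \<noteq> q"
  then obtain x y where "p = orbit s x" "q = orbit s y" by blast
  moreover have "orbit s x = orbit s y" if "z \<in> orbit s x" "z \<in> orbit s y" for z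
    using orbit_cyclic_eq3[OF cyclic_on_orbit'[OF perm]] that by metis
  ultimately show "disjnt p q" using \<open>p \<noteq> q\<close> by (auto simp: disjnt_def)
qed

lemma partition_of_cycle_type:
  assumes s: "s permutes {1..n}"
  shows "partition_of n (cycle_type n s)"
proof -
  let ?P = "orbit s ` {1..n}"
  have P: "partition_on {1..n} ?P" using orbits_partition[OF s] by simp
  have fin: "finite p" if "p \<in> ?P" for p
    using that permutes_orbit_subset[OF s] finite_subset[of p "{1..n}"] by auto
  have "sum_mset (cycle_type n s) = sum card ?P"
    by (simp add: cycle_type_def sum_unfold_sum_mset)
  also have "\<dots> = card (\<Union>?P)"
    using fin by (intro card_Union_disjoint[symmetric] partition_onD2[OF P])
  also have "\<dots> = n" using partition_onD1[OF P] by simp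
  finally have "sum_mset (cycle_type n s) = n" .
  moreover have "0 \<notin># cycle_type n s"
    using fin by (auto simp: cycle_type_def orbit_nonempty)
  ultimately show ?thesis by (simp add: partition_of_def is_partition_def)
qed

lemma frobenius_ch_in_p_filtration: "frobenius_ch n \<chi> \<in> p_filtration 0"
  unfolding frobenius_ch_def using partition_of_cycle_type
  by (intro p_filtration_scale p_filtration_sum p_part_in_p_filtration) (auto simp: partition_of_def)

lemma L_sym_in_p_filtration: "L_sym m \<in> p_filtration 0"
  unfolding L_sym_def by (rule frobenius_ch_in_p_filtration)

text \<open>All cycle types have sum n, so every summand becomes a multiple of X^n. What remains is
  the mean of the character, the multiplicity of the trivial representation.\<close>

lemma one_var_frobenius_ch:
  "one_var (frobenius_ch n \<chi>) = fps_const (1 / fact n * (\<Sum>s | s permutes {1..n}. \<chi> s)) * fps_X ^ n"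
proof -
  have "one_var (\<Sum>s | s permutes {1..n}. mfps_const (\<chi> s) * p_part (cycle_type n s)) =
      (\<Sum>s | s permutes {1..n}. fps_const (\<chi> s) * fps_X ^ n)"
    unfolding one_var_sum one_var_scale one_var_p_part
    using partition_of_cycle_type by (intro sum.cong) (auto simp: partition_of_def)
  also have "\<dots> = fps_const (\<Sum>s | s permutes {1..n}. \<chi> s) * fps_X ^ n"
    by (simp add: fps_eq_iff fps_sum_nth sum_distrib_right)
  finally show ?thesis
    by (simp only: frobenius_ch_def one_var_scale fps_const_mult[symmetric] mult.assoc)
qed

lemma one_var_L_sym: "m > 0 \<Longrightarrow> one_var (L_sym m) = (if m = 1 then fps_X else 0)"
proof (cases "m = 1")
  case True
  have "{s. s permutes {1 :: nat}} = {id}" by (auto simp: permutes_sing)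
  then show ?thesis
    using True by (simp add: L_sym_def one_var_frobenius_ch partition_homology_char_def)
next
  case False
  assume "m > 0"
  then have "m \<ge> 2" using False by simp
  from sum_sign_partition_homology_char[OF this] show ?thesis
    using False by (simp only: L_sym_def one_var_frobenius_ch) simp
qed

lemma L_part_in_p_filtration: "L_part r \<in> p_filtration 0"
  unfolding L_part_def
  by (intro p_filtration_0_prod plethysm_in_p_filtration h_sym_in_p_filtration L_sym_in_p_filtration)

text \<open>A part \<open>i \<noteq> 1\<close> makes its factor vanish: \<open>L_sym i\<close>
  specialises to 0, and \<open>h_sym\<close> of a positive multiplicity has no constant term. If all
  parts are 1, the only factor is the plethysm of \<open>h_sym k\<close> with
  \<open>L_sym 1\<close>, where \<open>k = 0\<close> leaves an empty product.\<close>

lemma one_var_L_part: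
  assumes "is_partition r"
  shows "one_var (L_part r) = (if r = replicate_mset (size r) 1 then fps_X ^ size r else 0)"
proof (cases "set_mset r \<subseteq> {1}")
  case True
  then have r: "r = replicate_mset (size r) 1" by (rule set_mset_subset_singletonD)
  define k where "k = size r"
  have r': "r = replicate_mset k 1" using r by (simp add: k_def)
  have "one_var (plethysm (h_sym k) (L_sym 1)) = fps_X ^ k oo fps_X ^ 1"
    using one_var_plethysm_X[OF h_sym_in_p_filtration, of "L_sym 1" 1 k]
    by (simp add: one_var_L_sym one_var_h_sym)
  then show ?thesis unfolding r' by (cases "k = 0") (auto simp: L_part_def)
next
  case False
  then obtain i where i: "i \<in># r" "i \<noteq> 1" by auto
  have "i > 0" using i assms by (metis is_partition_def gr0I)
  then have "one_var (plethysm (h_sym (count r i)) (L_sym i)) = 0"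
    using i by (intro one_var_plethysm_0 h_sym_in_p_filtration) (auto simp: one_var_L_sym mcoeff_h_sym)
  then have "one_var (L_part r) = 0"
    using i unfolding L_part_def one_var_prod by (intro prod_zero) auto
  moreover have "r \<noteq> replicate_mset (size r) 1" using False by (metis in_replicate_mset singletonI subsetI)
  ultimately show ?thesis by simp
qed

section \<open>Coefficients of infinite sums and products\<close>

lemma The_eventually_eq:
  assumes "F \<noteq> bot" "eventually (\<lambda>x. f x = c) F"
  shows "(THE c. eventually (\<lambda>x. f x = c) F) = c"
proof (rule the_equality)
  show "eventually (\<lambda>x. f x = c) F" by fact
  fix d assume "eventually (\<lambda>x. f x = d) F"
  with assms(2) have "eventually (\<lambda>x. c = d) F" by eventually_elim simp
  then show "d = c" using assms(1) by simp
qed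

lemma mcoeff_infsum:
  assumes "finite K" "K \<subseteq> I" "\<And>i. i \<in> I - K \<Longrightarrow> mcoeff (F i) M = 0"
  shows "mcoeff (mfps_infsum F I) M = (\<Sum>i\<in>K. mcoeff (F i) M)"
  unfolding mfps_infsum_def mcoeff_Abs_mfps
proof (rule The_eventually_eq)
  show "eventually (\<lambda>J. mcoeff (sum F J) M = (\<Sum>i\<in>K. mcoeff (F i) M)) (finite_subsets_at_top I)"
    unfolding eventually_finite_subsets_at_top
  proof (intro exI[of _ K] conjI allI impI)
    fix J assume "finite J \<and> K \<subseteq> J \<and> J \<subseteq> I"
    then show "mcoeff (sum F J) M = (\<Sum>i\<in>K. mcoeff (F i) M)"
      unfolding mcoeff_sum using assms(3) by (intro sum.mono_neutral_right) auto
  qed fact+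
qed simp

lemma mcoeff_infprod:
  assumes "finite K" "K \<subseteq> I"
    and "\<And>J. finite J \<Longrightarrow> K \<subseteq> J \<Longrightarrow> J \<subseteq> I \<Longrightarrow> mcoeff (prod F J) M = mcoeff (prod F K) M"
  shows "mcoeff (mfps_infprod F I) M = mcoeff (prod F K) M"
  unfolding mfps_infprod_def mcoeff_Abs_mfps
proof (rule The_eventually_eq)
  show "eventually (\<lambda>J. mcoeff (prod F J) M = mcoeff (prod F K) M) (finite_subsets_at_top I)"
    unfolding eventually_finite_subsets_at_top
  proof (intro exI[of _ K] conjI allI impI)
    fix J assume "finite J \<and> K \<subseteq> J \<and> J \<subseteq> I"
    then show "mcoeff (prod F J) M = mcoeff (prod F K) M" by (intro assms(3)) simp_all
  qed fact+
qed simp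

text \<open>Each additional factor agrees with the series 1 on all submonomials of \<open>M\<close>;
  so does their product, and multiplication by it leaves the coefficient at \<open>M\<close>
  unchanged.\<close>

lemma mcoeff_prod_superset:
  assumes J: "finite J" "K \<subseteq> J"
    and one: "\<And>i B. i \<in> J - K \<Longrightarrow> B \<subseteq># M \<Longrightarrow> mcoeff (F i) B = (if B = {#} then 1 else 0)"
  shows "mcoeff (prod F J) M = mcoeff (prod F K) M"
proof -
  have mult: "mcoeff (f * g) B = mcoeff f B"
    if g: "\<And>B. B \<subseteq># M \<Longrightarrow> mcoeff g B = (if B = {#} then 1 else 0)" and "B \<subseteq># M" for f g B
  proof -
    have "mcoeff (f * g) B = (\<Sum>(A, B)\<in>{(B, {#})}. mcoeff f A * mcoeff g B)"
      unfolding mcoeff_mult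
    proof (rule sum.mono_neutral_right)
      show "\<forall>p\<in>{(A, C). A + C = B} - {(B, {#})}. (case p of (A, B) \<Rightarrow> mcoeff f A * mcoeff g B) = 0"
      proof
        fix p assume p: "p \<in> {(A, C). A + C = B} - {(B, {#})}"
        then obtain A C where AC: "p = (A, C)" "A + C = B" by auto
        then have "C \<noteq> {#}" using p by auto
        moreover from AC have "C \<subseteq># M"
          using \<open>B \<subseteq># M\<close> by (metis mset_subset_eq_add_right subset_mset.order_trans)
        then show "(case p of (A, B) \<Rightarrow> mcoeff f A * mcoeff g B) = 0"
          using g AC \<open>C \<noteq> {#}\<close> by simp
      qed
    qed (auto simp: finite_mset_splits)
    then show ?thesis using g[of "{#}"] by simp
  qed
  have "mcoeff (prod F S) B = (if B = {#} then 1 else 0)"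
    if "finite S" "S \<subseteq> J - K" "B \<subseteq># M" for S B
    using that
  proof (induction S arbitrary: B rule: finite_induct)
    case empty
    then show ?case by (simp add: mcoeff_1)
  next
    case (insert i S)
    have "mcoeff (F i * prod F S) B = mcoeff (F i) B"
      using insert by (intro mult) auto
    then show ?case using insert one by simp
  qed
  then have "mcoeff (prod F K * prod F (J - K)) M = mcoeff (prod F K) M"
    using J by (intro mult) auto
  moreover have "prod F K * prod F (J - K) = prod F J"
    using J by (metis mult.commute prod.subset_diff)
  ultimately show ?thesis by simp
qed

lemma mcoeff_prod_in_p_filtration:
  fixes F :: "'i \<Rightarrow> (yz_var, symfun) mfps"
  assumes "finite J" "\<And>i M. i \<in> J \<Longrightarrow> mcoeff (F i) M \<in> p_filtration 0"
  shows "mcoeff (prod F J) M \<in> p_filtration 0"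
  using assms
proof (induction J arbitrary: M rule: finite_induct)
  case empty
  then show ?case by (simp add: mcoeff_1 one_in_p_filtration p_filtration_0)
next
  case (insert i J)
  have "mcoeff (F i) A * mcoeff (prod F J) B \<in> p_filtration (0 + 0)" for A B
    using insert by (intro p_filtration_mult) auto
  then show ?case using insert by (auto simp: mcoeff_mult intro!: p_filtration_sum)
qed

section \<open>Monomials in y and z and the factor of a single Lyndon word\<close>

lemma yz_monomial_inject [simp]: "yz_monomial a b = yz_monomial a' b' \<longleftrightarrow> a = a' \<and> b = b'"
proof
  assume eq: "yz_monomial a b = yz_monomial a' b'"
  have Y: "count (yz_monomial a b) (Y i) = count a i" and Z: "count (yz_monomial a b) (Z i) = count b i" for a b i
  proof -
    have "inj Y" "inj Z" by (auto simp: inj_def)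
    then have "Y -` {Y i} \<inter> set_mset a = (if i \<in># a then {i} else {})"
      "Z -` {Z i} \<inter> set_mset b = (if i \<in># b then {i} else {})"
      "Z -` {Y i} = {}" "Y -` {Z i} = {}" by auto
    then show "count (yz_monomial a b) (Y i) = count a i" "count (yz_monomial a b) (Z i) = count b i"
      by (simp_all add: yz_monomial_def count_image_mset not_in_iff)
  qed
  show "a = a' \<and> b = b'"
    using Y Z eq by (metis multiset_eqI)
qed simp

lemma yz_monomial_add: "yz_monomial a b + yz_monomial a' b' = yz_monomial (a + a') (b + b')"
  by (simp add: yz_monomial_def)

definition lyndon_monomial :: "nat list \<Rightarrow> nat multiset \<Rightarrow> yz_var multiset" where
  "lyndon_monomial w r = yz_monomial (image_mset (\<lambda>i. i * sum_list w) r)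
     (mset (concat (replicate (sum_mset r) w)))"

text \<open>The case \<open>r = {#1#}\<close> of \<open>lyndon_monomial\<close>; its powers are the
  monomials of the factor that survive specialisation.\<close>

definition word_monomial :: "nat list \<Rightarrow> yz_var multiset" where
  "word_monomial w = yz_monomial {#sum_list w#} (mset w)"

lemma lyndon_sum_list_pos: "lyndon w \<Longrightarrow> sum_list w > 0"
  by (cases w) (auto simp: lyndon_def)

lemma mset_concat_replicate: "mset (concat (replicate k w)) = repeat_mset k (mset w)"
  by (induction k) simp_all

text \<open>The y-part alone determines \<open>r\<close>, since its indices are the parts of
  \<open>r\<close> scaled by the positive number \<open>sum_list w\<close>.\<close>

lemma lyndon_monomial_inject:
  assumes "lyndon w" "lyndon_monomial w r = lyndon_monomial w r'"
  shows "r = r'"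
proof -
  have "inj (\<lambda>i. i * sum_list w)"
    using lyndon_sum_list_pos[OF assms(1)] by (auto simp: inj_def simp del: sum_list_eq_0_iff)
  moreover have "image_mset (\<lambda>i. i * sum_list w) r = image_mset (\<lambda>i. i * sum_list w) r'"
    using assms(2) by (simp add: lyndon_monomial_def)
  ultimately show ?thesis by (metis multiset.inj_map injD)
qed

text \<open>By injectivity at most one partition contributes to any given monomial, so the partial
  sums are stable as soon as it is included.\<close>

lemma mcoeff_lyndon_factor:
  assumes w: "lyndon w"
  shows "is_partition r \<Longrightarrow> mcoeff (lyndon_factor w) (lyndon_monomial w r) = plethysm (L_part r) (h_part (mset w))"
    and "(\<And>r. is_partition r \<Longrightarrow> M \<noteq> lyndon_monomial w r) \<Longrightarrow> mcoeff (lyndon_factor w) M = 0"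
proof -
  have F: "lyndon_factor w = mfps_infsum
      (\<lambda>r. mfps_monom (lyndon_monomial w r) (plethysm (L_part r) (h_part (mset w)))) (Collect is_partition)"
    by (simp add: lyndon_factor_def lyndon_monomial_def)
  show "mcoeff (lyndon_factor w) (lyndon_monomial w r) = plethysm (L_part r) (h_part (mset w))"
    if r: "is_partition r"
    unfolding F using r lyndon_monomial_inject[OF w]
    by (subst mcoeff_infsum[of "{r}"]) (auto simp: mcoeff_monom)
  show "mcoeff (lyndon_factor w) M = 0" if "\<And>r. is_partition r \<Longrightarrow> M \<noteq> lyndon_monomial w r"
    unfolding F using that by (subst mcoeff_infsum[of "{}"]) (auto simp: mcoeff_monom)
qed

lemma mcoeff_lyndon_factor_in_p_filtration:
  assumes "lyndon w"
  shows "mcoeff (lyndon_factor w) M \<in> p_filtration 0"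
proof (cases "\<exists>r. is_partition r \<and> M = lyndon_monomial w r")
  case True
  moreover have "h_part (mset w) \<in> p_filtration 0"
    unfolding h_part_def by (intro p_filtration_0_prod_mset h_sym_in_p_filtration)
  ultimately show ?thesis
    using mcoeff_lyndon_factor(1)[OF assms] L_part_in_p_filtration plethysm_in_p_filtration by auto
next
  case False
  then have "mcoeff (lyndon_factor w) M = 0" by (intro mcoeff_lyndon_factor(2)[OF assms]) auto
  then show ?thesis by (simp add: p_filtration_0)
qed

text \<open>A nonempty partition has positive sum, so its monomial contains all the z-variables of
  \<open>w\<close> at least once. Without them only the empty partition is left, with coefficient
  1.\<close>

lemma mcoeff_lyndon_factor_small:
  assumes w: "lyndon w" and "\<not> image_mset Z (mset w) \<subseteq># B"
  shows "mcoeff (lyndon_factor w) B = (if B = {#} then 1 else 0)"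
proof (cases "\<exists>r. is_partition r \<and> B = lyndon_monomial w r")
  case True
  then obtain r where r: "is_partition r" "B = lyndon_monomial w r" by blast
  have "sum_mset r = 0"
  proof (rule ccontr)
    assume "sum_mset r \<noteq> 0"
    then obtain k where "sum_mset r = Suc k" by (metis not0_implies_Suc)
    then have "B = image_mset Z (mset w) +
        (image_mset Y (image_mset (\<lambda>i. i * sum_list w) r) + image_mset Z (repeat_mset k (mset w)))"
      unfolding r(2) lyndon_monomial_def yz_monomial_def mset_concat_replicate
      by (simp add: ac_simps)
    then show False using assms(2) by simp
  qed
  then have "r = {#}" using r(1) by (cases r) (auto simp: is_partition_def)
  then show ?thesis
    using mcoeff_lyndon_factor(1)[OF w, of "{#}"] r
    by (simp add: lyndon_monomial_def yz_monomial_def L_part_def)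
next
  case False
  have "B \<noteq> {#}"
    using False by (auto dest!: spec[of _ "{#}"] simp: lyndon_monomial_def yz_monomial_def is_partition_def)
  moreover have "mcoeff (lyndon_factor w) B = 0"
    using False by (intro mcoeff_lyndon_factor(2)[OF w]) auto
  ultimately show ?thesis by simp
qed

text \<open>The power of X to which the coefficient at a monomial specialises: each copy of a word
  contributes the sum of its letters, and these are recorded by the z-variables.\<close>

definition z_weight :: "yz_var multiset \<Rightarrow> nat" where
  "z_weight M = (\<Sum>v\<in>#M. case v of Y _ \<Rightarrow> 0 | Z i \<Rightarrow> i)"

lemma z_weight_add [simp]: "z_weight (A + B) = z_weight A + z_weight B"
  by (simp add: z_weight_def)

lemma z_weight_repeat [simp]: "z_weight (repeat_mset k A) = k * z_weight A"
  by (induction k) (simp_all add: z_weight_def)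

lemma z_weight_yz_monomial: "z_weight (yz_monomial a b) = sum_mset b"
  by (simp add: z_weight_def yz_monomial_def multiset.map_comp comp_def)

lemma z_weight_word_monomial: "z_weight (word_monomial w) = sum_list w"
  by (simp add: word_monomial_def z_weight_yz_monomial sum_mset_sum_list)

lemma lyndon_monomial_replicate_1: "lyndon_monomial w (replicate_mset k 1) = repeat_mset k (word_monomial w)"
  unfolding lyndon_monomial_def mset_concat_replicate
  by (induction k) (simp_all add: word_monomial_def yz_monomial_def)

lemma word_monomial_nonempty: "word_monomial w \<noteq> {#}"
  by (simp add: word_monomial_def yz_monomial_def)

lemma fps_X_power_compose:
  assumes "d > 0"
  shows "(fps_X ^ k oo fps_X ^ d :: complex fps) = fps_X ^ (k * d)"
proof -
  have X: "fps_nth (fps_X ^ d :: complex fps) 0 = 0" using assms by simp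
  then have "(fps_X ^ k oo fps_X ^ d :: complex fps) = (fps_X ^ d) ^ k"
    by (simp add: fps_compose_power[OF X, symmetric])
  then show ?thesis by (simp add: mult.commute flip: power_mult)
qed

text \<open>If \<open>B\<close> belongs to the partition \<open>r\<close>, its coefficient
  specialises to \<open>one_var (L_part r)\<close> at X to the power \<open>sum_list w\<close>. This
  is nonzero only if all parts of \<open>r\<close> are 1, that is, if \<open>B\<close> is a power of
  \<open>word_monomial w\<close>.\<close>

lemma one_var_lyndon_factor:
  assumes w: "lyndon w"
  shows "one_var (mcoeff (lyndon_factor w) B) =
    (if \<exists>k. B = repeat_mset k (word_monomial w) then fps_X ^ z_weight B else 0)"
proof (cases "\<exists>r. is_partition r \<and> B = lyndon_monomial w r")
  case True
  then obtain r where r: "is_partition r" "B = lyndon_monomial w r" by blast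
  have pos: "sum_list w > 0" by (rule lyndon_sum_list_pos[OF w])
  have "one_var (h_part (mset w)) = fps_X ^ sum_list w"
    by (simp add: one_var_h_part sum_mset_sum_list)
  then have "one_var (plethysm (L_part r) (h_part (mset w))) = one_var (L_part r) oo fps_X ^ sum_list w"
    using pos by (intro one_var_plethysm_X L_part_in_p_filtration)
  then have *: "one_var (mcoeff (lyndon_factor w) B) = one_var (L_part r) oo fps_X ^ sum_list w"
    using mcoeff_lyndon_factor(1)[OF w r(1)] r(2) by simp
  show ?thesis
  proof (cases "\<exists>k. B = repeat_mset k (word_monomial w)")
    case True
    then obtain k where k: "B = repeat_mset k (word_monomial w)" ..
    then have r1: "r = replicate_mset k 1"
      using r(2) by (intro lyndon_monomial_inject[OF w]) (simp only: lyndon_monomial_replicate_1)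
    have "one_var (L_part r) = fps_X ^ k" using one_var_L_part[OF r(1)] r1 by simp
    then show ?thesis
      using * k pos by (auto simp: z_weight_word_monomial fps_X_power_compose simp del: sum_list_eq_0_iff)
  next
    case False
    then have "r \<noteq> replicate_mset (size r) 1"
      using r(2) lyndon_monomial_replicate_1 by metis
    then show ?thesis using one_var_L_part[OF r(1)] * False by simp
  qed
next
  case False
  have "B \<noteq> repeat_mset k (word_monomial w)" for k
    using False lyndon_monomial_replicate_1[of w k] by (auto simp: is_partition_def dest!: spec[of _ "replicate_mset k 1"] split: if_splits)
  moreover have "mcoeff (lyndon_factor w) B = 0"
    using False by (intro mcoeff_lyndon_factor(2)[OF w]) auto
  ultimately show ?thesis by simp
qed

section \<open>Counting multisets of Lyndon words\<close>

definition word_multisets :: "nat list set \<Rightarrow> yz_var multiset \<Rightarrow> nat list multiset set" where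
  "word_multisets J M = {K. set_mset K \<subseteq> J \<and> (\<Sum>w\<in>#K. word_monomial w) = M}"

text \<open>Separates the copies of \<open>w\<close> from the remaining words. The induced splitting
  of \<open>M\<close> is kept in the target so that it matches the index set in the coefficient of a
  product.\<close>

lemma word_multisets_insert:
  assumes "w \<notin> J"
  shows "bij_betw
    (\<lambda>K. ((repeat_mset (count K w) (word_monomial w), \<Sum>v\<in>#filter_mset (\<lambda>v. v \<noteq> w) K. word_monomial v),
       filter_mset (\<lambda>v. v \<noteq> w) K))
    (word_multisets (insert w J) M)
    (SIGMA p:{(A, B). A + B = M \<and> (\<exists>k. A = repeat_mset k (word_monomial w))}. word_multisets J (snd p))"
    (is "bij_betw ?f ?S ?T")
proof (rule bij_betw_byWitness[where
    f' = "\<lambda>((A, B), K). replicate_mset (size A div size (word_monomial w)) w + K"])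
  let ?m = "word_monomial w" and ?rest = "filter_mset (\<lambda>v. v \<noteq> w)"
  let ?g = "\<lambda>((A, B), K). replicate_mset (size A div size ?m) w + K"
  have size: "size (repeat_mset k ?m) div size ?m = k" for k
    using word_monomial_nonempty[of w] by simp
  have decomp: "replicate_mset (count K w) w + ?rest K = K" for K
    using multiset_partition[of K "\<lambda>v. v = w"] by (simp add: filter_eq_replicate_mset)
  have sum_replicate: "sum_mset (replicate_mset k ?m) = repeat_mset k ?m" for k
    by (induction k) simp_all
  show "\<forall>K\<in>?S. ?g (?f K) = K"
    by (simp add: size decomp del: size_repeat_mset)
  have sum_split: "repeat_mset (count K w) ?m + (\<Sum>v\<in>#?rest K. word_monomial v) = (\<Sum>v\<in>#K. word_monomial v)" for K
  proof -
    have "(\<Sum>v\<in>#replicate_mset (count K w) w + ?rest K. word_monomial v) =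
        repeat_mset (count K w) ?m + (\<Sum>v\<in>#?rest K. word_monomial v)"
      by (simp add: sum_replicate)
    then show ?thesis by (simp only: decomp)
  qed
  have rest: "?rest K = K" "count K w = 0" if "set_mset K \<subseteq> J" for K
    using that assms by (auto simp: filter_mset_eq_conv not_in_iff[symmetric])
  show "\<forall>p\<in>?T. ?f (?g p) = p"
    by (auto simp: word_multisets_def size rest simp del: size_repeat_mset)
  show "?f ` ?S \<subseteq> ?T"
    using sum_split by (auto simp: word_multisets_def)
  show "?g ` ?T \<subseteq> ?S"
    by (auto simp: word_multisets_def size sum_replicate simp del: size_repeat_mset
        dest: subsetD split: if_splits)
qed

text \<open>The factor of the inserted word contributes coefficient 1 for each of its powers, so the
  counts for the remaining words add up as in \<open>word_multisets_insert\<close>, and the weights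
  add as well. Finiteness is part of the induction because the cardinality of the disjoint union
  depends on it.\<close>

lemma one_var_prod_lyndon_factor:
  assumes "finite J" "\<And>w. w \<in> J \<Longrightarrow> lyndon w"
  shows "finite (word_multisets J M) \<and>
    one_var (mcoeff (prod lyndon_factor J) M) = of_nat (card (word_multisets J M)) * fps_X ^ z_weight M"
  using assms
proof (induction J arbitrary: M rule: finite_induct)
  case empty
  have "word_multisets {} M = (if M = {#} then {{#}} else {})" by (auto simp: word_multisets_def)
  then show ?case by (simp add: mcoeff_1 z_weight_def)
next
  case (insert w J)
  let ?m = "word_monomial w"
  let ?D = "{(A, B). A + B = M}" and ?D' = "{(A, B). A + B = M \<and> (\<exists>k. A = repeat_mset k ?m)}"
  have IH: "finite (word_multisets J B)"
    "one_var (mcoeff (prod lyndon_factor J) B) = of_nat (card (word_multisets J B)) * fps_X ^ z_weight B" for B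
    using insert by auto
  have fin: "finite ?D'" by (rule finite_subset[OF _ finite_mset_splits[of M]]) auto
  note bij = word_multisets_insert[OF insert.hyps(2), of M]
  have "finite (SIGMA p:?D'. word_multisets J (snd p))" using fin IH(1) by auto
  then have finite: "finite (word_multisets (insert w J) M)" using bij bij_betw_finite by blast
  have "card (word_multisets (insert w J) M) = (\<Sum>p\<in>?D'. card (word_multisets J (snd p)))"
    unfolding bij_betw_same_card[OF bij] using fin IH(1) by (intro card_SigmaI) auto
  moreover have "one_var (mcoeff (prod lyndon_factor (insert w J)) M) =
      of_nat (\<Sum>p\<in>?D'. card (word_multisets J (snd p))) * fps_X ^ z_weight M"
  proof -
    have "one_var (mcoeff (prod lyndon_factor (insert w J)) M) =
        (\<Sum>(A, B)\<in>?D. one_var (mcoeff (lyndon_factor w) A) * one_var (mcoeff (prod lyndon_factor J) B))"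
      using insert.hyps by (simp add: mcoeff_mult split_def)
    \<comment> \<open>Splittings whose first part is not a power of \<open>?m\<close> have
      coefficient 0 after specialisation.\<close>
    also have "\<dots> = (\<Sum>(A, B)\<in>?D'. one_var (mcoeff (lyndon_factor w) A) * one_var (mcoeff (prod lyndon_factor J) B))"
      using insert.prems by (intro sum.mono_neutral_right) (auto simp: finite_mset_splits one_var_lyndon_factor split: if_splits)
    also have "\<dots> = (\<Sum>p\<in>?D'. of_nat (card (word_multisets J (snd p))) * fps_X ^ z_weight M)"
    proof (rule sum.cong[OF refl], clarify)
      fix A B k assume M: "M = repeat_mset k ?m + B"
      show "one_var (mcoeff (lyndon_factor w) (repeat_mset k ?m)) * one_var (mcoeff (prod lyndon_factor J) B) =
          of_nat (card (word_multisets J (snd (repeat_mset k ?m, B)))) * fps_X ^ z_weight (repeat_mset k ?m + B)"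
        using insert.prems by (subst one_var_lyndon_factor) (auto simp: IH(2) power_add)
    qed
    finally show ?thesis by (simp add: sum_distrib_right)
  qed
  ultimately show ?case using finite by simp
qed

lemma finite_lyndon_submonomial: "finite {w. lyndon w \<and> image_mset Z (mset w) \<subseteq># M}"
proof (rule finite_subset)
  show "finite {w. set w \<subseteq> {i. Z i \<in># M} \<and> length w \<le> size M}"
  proof (rule finite_lists_length_le)
    have "finite (Z -` set_mset M)" by (rule finite_vimageI) (auto simp: inj_def)
    then show "finite {i. Z i \<in># M}" by (simp add: vimage_def)
  qed
  show "{w. lyndon w \<and> image_mset Z (mset w) \<subseteq># M} \<subseteq> {w. set w \<subseteq> {i. Z i \<in># M} \<and> length w \<le> size M}"
  proof clarify
    fix w assume "image_mset Z (mset w) \<subseteq># M"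
    then have "size (image_mset Z (mset w)) \<le> size M" "set_mset (image_mset Z (mset w)) \<subseteq> set_mset M"
      by (rule size_mset_mono, rule set_mset_mono)
    then show "set w \<subseteq> {i. Z i \<in># M} \<and> length w \<le> size M" by auto
  qed
qed

lemma sum_word_monomial: "(\<Sum>w\<in>#K. word_monomial w) = yz_monomial (image_mset sum_list K) (\<Sum>w\<in>#K. mset w)"
proof (induction K)
  case empty
  then show ?case by (simp add: yz_monomial_def)
next
  case (add w K)
  then show ?case by (simp add: word_monomial_def yz_monomial_add)
qed

theorem proposition4p5:
  fixes n :: nat and lam \<mu> :: "nat multiset"
  assumes "n \<ge> 1" and "partition_of n lam" and "partition_of n \<mu>"
  shows "hall (h_sym n)
           (mcoeff (mfps_infprod lyndon_factor {w. lyndon w}) (yz_monomial lam \<mu>)) =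
         of_nat (card {\<alpha> :: nat list. mset \<alpha> = \<mu> \<and> lyndon_type \<alpha> = lam})"
proof -
  define M where "M = yz_monomial lam \<mu>"
  \<comment> \<open>Every other Lyndon word has a factor that looks like 1 on all submonomials of
    \<open>M\<close>, so these finitely many words determine the coefficient.\<close>
  define J where "J = {w. lyndon w \<and> image_mset Z (mset w) \<subseteq># M}"
  have J: "finite J" "J \<subseteq> {w. lyndon w}" "\<And>w. w \<in> J \<Longrightarrow> lyndon w"
    using finite_lyndon_submonomial by (auto simp: J_def)
  have infprod: "mcoeff (mfps_infprod lyndon_factor {w. lyndon w}) M = mcoeff (prod lyndon_factor J) M"
  proof (rule mcoeff_infprod[OF J(1,2)])
    fix J' assume J': "finite J'" "J \<subseteq> J'" "J' \<subseteq> {w. lyndon w}"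
    show "mcoeff (prod lyndon_factor J') M = mcoeff (prod lyndon_factor J) M"
    proof (rule mcoeff_prod_superset[OF J'(1,2)])
      fix w B assume w: "w \<in> J' - J" and B: "B \<subseteq># M"
      then have "\<not> image_mset Z (mset w) \<subseteq># B"
        using J'(3) by (auto simp: J_def intro: subset_mset.order_trans)
      then show "mcoeff (lyndon_factor w) B = (if B = {#} then 1 else 0)"
        using w J'(3) by (intro mcoeff_lyndon_factor_small) auto
    qed
  qed
  \<comment> \<open>Only for a genuine symmetric function does \<open>hall\<close> read the
    coefficient at the n-th power of variable 0.\<close>
  have "mcoeff (prod lyndon_factor J) M \<in> p_filtration 0"
    using J mcoeff_lyndon_factor_in_p_filtration by (intro mcoeff_prod_in_p_filtration) auto
  then have "hall (h_sym n) (mcoeff (prod lyndon_factor J) M) =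
      fps_nth (one_var (mcoeff (prod lyndon_factor J) M)) n"
    using assms(1) by (simp add: hall_h_sym one_var_nth)
  also have "\<dots> = of_nat (card (word_multisets J M))"
  proof -
    have "z_weight M = n" using assms(3) by (simp add: M_def z_weight_yz_monomial partition_of_def)
    then show ?thesis
      using one_var_prod_lyndon_factor[OF J(1,3), of M]
      by (simp add: fps_of_nat[symmetric] fps_X_power_iff del: fps_of_nat)
  qed
  also have "word_multisets J M =
      {K. (\<forall>w\<in>#K. lyndon w) \<and> image_mset sum_list K = lam \<and> (\<Sum>w\<in>#K. mset w) = \<mu>}"
  proof -
    \<comment> \<open>The restriction to \<open>J\<close> is automatic: a word in a multiset with
      total monomial \<open>M\<close> contributes its z-variables to \<open>M\<close>.\<close>
    have "w \<in> J" if K: "w \<in># K" "lyndon w" "(\<Sum>w\<in>#K. word_monomial w) = M" for w K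
    proof -
      obtain K' where "K = add_mset w K'" using multi_member_split[OF K(1)] by blast
      then have "M = image_mset Z (mset w) + ({#Y (sum_list w)#} + (\<Sum>w\<in>#K'. word_monomial w))"
        using K(3) by (auto simp: word_monomial_def yz_monomial_def)
      then show ?thesis using K(2) by (simp add: J_def)
    qed
    then show ?thesis
      using J(3) by (auto simp: word_multisets_def sum_word_monomial M_def)
  qed
  also have "card \<dots> = card {\<alpha>. mset \<alpha> = \<mu> \<and> lyndon_type \<alpha> = lam}"
    using assms(3) by (intro card_words_eq_card_lyndon_multisets[symmetric])
      (simp add: partition_of_def is_partition_def)
  finally show ?thesis by (simp only: infprod[unfolded M_def] M_def)
qed

end
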